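(* Let $m$ and $n$ be non-negative integers, and let $F^0_{m,n}(p,q)$, $F^1_{m,n}(p,q)$, $F^2_{m,n}(p,q)$ be the components of the 3-dissection of the product $F_{m,n}(p,q)$ defined in the context. Then for $l=0,1,2$ we have $$ \begin{aligned} F^l_{m,n}(p,q)={}&(-1)^{\binom{l+1}{2}}\,p^{m(m+1)n}\,q^{-mn^2}\\ &\times\sum_{\substack{n\ge\lambda_1\ge\lambda_2\ge\cdots\ge\lambda_{2m+1}\ge -n\\ |\lambda|\equiv -l \pmod 3}} \Bigg(\prod_{1\le i<j\le 2m+1} \frac{(1-p^{j-i}q^{\lambda_i-\lambda_j})\,(p^{j-i+1};q)_{\lambda_i-\lambda_j}} {(1-p^{j-i})\,(p^{j-i-1}q;q)_{\lambda_i-\lambda_j}}\\ &\qquad\times\prod_{i=1}^{2m+1} \frac{(p^{i-1}q;q)_{2n}} {(p^{i-1}q;q)_{n-\lambda_i}\,(p^{2m+1-i}q;q)_{n+\lambda_i}}\\ &\qquad\times(-1)^{|\lambda|}\,p^{\sum_{i=1}^{2m+1}(i-1-m)\lambda_i}\; q^{\binom{\lambda_1+1}{2}+\cdots+\binom{\lambda_{2m+1}+1}{2}-\frac{|\lambda|+l}{3}} \Bigg), \end{aligned} $$ where the sum is over all non-increasing sequences of integers (not necessarily non-negative) $\lambda=(\lambda_1,\dots,\lambda_{2m+1})$ satisfying the displayed conditions.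
   Context: Here $p$ and $q$ are formal variables (the identity is an identity of rational functions in $p$ and $q$). For a non-negative integer $N$, the $q$-shifted factorial is $(a;q)_N:=\prod_{j=0}^{N-1}(1-aq^j)$, and $(a_1,\dots,a_r;q)_N:=\prod_{k=1}^r(a_k;q)_N$; the same notation is used with base $q^3$ or $q^{-3}$ in place of $q$. For an integer $x$, $\binom{x+1}{2}=x(x+1)/2$. For a finite non-increasing sequence of integers $\lambda=(\lambda_1,\dots,\lambda_{2m+1})$, $|\lambda|:=\lambda_1+\cdots+\lambda_{2m+1}$. For non-negative integers $m,n$ define $$F_{m,n}(p,q):=(q,q^2;q^3)_n\prod_{j=1}^m(p^jq,p^jq^2;q^3)_n\,(p^jq^{-1},p^jq^{-2};q^{-3})_n,$$ which is a polynomial in $p$ of degree at most $2m(m+1)n$ whose coefficients are Laurent polynomials in $q$. The Laurent polynomials $A_{m,n,k}(q),B_{m,n,k}(q),C_{m,n,k}(q)$ are uniquely defined by $$F_{m,n}(p,q)=\sum_{k\ge 0}p^k\left[A_{m,n,k}(q^3)-qB_{m,n,k}(q^3)-q^2C_{m,n,k}(q^3)\right],$$ by separating the powers of $q$ according to residues of exponents modulo 3. Set $$F^0_{m,n}(p,q):=\sum_{k=0}^{2m(m+1)n}p^kA_{m,n,k}(q),\quad F^1_{m,n}(p,q):=\sum_{k=0}^{2m(m+1)n}p^kB_{m,n,k}(q),\quad F^2_{m,n}(p,q):=\sum_{k=0}^{2m(m+1)n}p^kC_{m,n,k}(q),$$ so that $F_{m,n}(p,q)=F^0_{m,n}(p,q^3)-qF^1_{m,n}(p,q^3)-q^2F^2_{m,n}(p,q^3)$.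 *)

theory Defs
  imports
    "HOL-Library.Poly_Mapping"
    "HOL-Library.FuncSet"
    "HOL-Number_Theory.Cong"
    "HOL-Computational_Algebra.Polynomial_Factorial"
begin

definition qpoch :: "'a::comm_ring_1 \<Rightarrow> 'a \<Rightarrow> nat \<Rightarrow> 'a" where
  "qpoch a q N = (\<Prod>j<N. 1 - a * q ^ j)"

text \<open>
  Laurent polynomials in \<open>q\<close> are finitely supported maps from exponents to coefficients, with the
  convolution product.  The rational functions in \<open>p\<close> and \<open>q\<close> are obtained as the fraction field of
  the ring \<open>\<int>[q, q\<^sup>-\<^sup>1][p]\<close>.
\<close>

type_synonym laurent = "int \<Rightarrow>\<^sub>0 int"
type_synonym ratfun = "laurent poly fract"

definition pX :: "laurent poly" where
  "pX = [:0, 1:]"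

definition qX :: "int \<Rightarrow> laurent poly" where
  "qX i = [:Poly_Mapping.single i 1:]"

definition p_var :: ratfun where
  "p_var = to_fract pX"

definition q_var :: ratfun where
  "q_var = to_fract (qX 1)"

definition F_prod :: "nat \<Rightarrow> nat \<Rightarrow> laurent poly" where
  "F_prod m n =
     qpoch (qX 1) (qX 3) n * qpoch (qX 2) (qX 3) n *
     (\<Prod>j=1..m.
        qpoch (pX ^ j * qX 1) (qX 3) n * qpoch (pX ^ j * qX 2) (qX 3) n *
        (qpoch (pX ^ j * qX (-1)) (qX (-3)) n * qpoch (pX ^ j * qX (-2)) (qX (-3)) n))"

text \<open>
  \<open>residue_part r f\<close> collects the exponents congruent to \<open>r\<close> modulo \<open>3\<close>: its coefficient at \<open>q\<^sup>j\<close>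
  is the coefficient of \<open>f\<close> at \<open>q\<^sup>3\<^sup>j\<^sup>+\<^sup>r\<close>.
\<close>

definition residue_part :: "int \<Rightarrow> laurent \<Rightarrow> laurent" where
  "residue_part r f = Poly_Mapping.map_key (\<lambda>j. 3 * j + r) f"

definition A_coeff :: "nat \<Rightarrow> nat \<Rightarrow> nat \<Rightarrow> laurent" where
  "A_coeff m n k = residue_part 0 (poly.coeff (F_prod m n) k)"

definition B_coeff :: "nat \<Rightarrow> nat \<Rightarrow> nat \<Rightarrow> laurent" where
  "B_coeff m n k = - residue_part 1 (poly.coeff (F_prod m n) k)"

definition C_coeff :: "nat \<Rightarrow> nat \<Rightarrow> nat \<Rightarrow> laurent" where
  "C_coeff m n k = - residue_part 2 (poly.coeff (F_prod m n) k)"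

definition F0 :: "nat \<Rightarrow> nat \<Rightarrow> laurent poly" where
  "F0 m n = (\<Sum>k=0..2*m*(m+1)*n. pX ^ k * [:A_coeff m n k:])"

definition F1 :: "nat \<Rightarrow> nat \<Rightarrow> laurent poly" where
  "F1 m n = (\<Sum>k=0..2*m*(m+1)*n. pX ^ k * [:B_coeff m n k:])"

definition F2 :: "nat \<Rightarrow> nat \<Rightarrow> laurent poly" where
  "F2 m n = (\<Sum>k=0..2*m*(m+1)*n. pX ^ k * [:C_coeff m n k:])"

text \<open>
  The sequences \<open>n \<ge> \<lambda>\<^sub>1 \<ge> \<dots> \<ge> \<lambda>\<^sub>N \<ge> -n\<close> of integers, as functions on \<open>{1..N}\<close> that are
  undefined elsewhere, so that each sequence is represented exactly once.
\<close>

definition noninc_seqs :: "nat \<Rightarrow> nat \<Rightarrow> (nat \<Rightarrow> int) set" where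
  "noninc_seqs N n =
     {lam \<in> {1..N} \<rightarrow>\<^sub>E {- int n..int n}. \<forall>i\<in>{1..N}. \<forall>j\<in>{1..N}. i \<le> j \<longrightarrow> lam i \<ge> lam j}"

text \<open>
  The substitution \<open>q \<mapsto> q\<^sup>3\<close>, used to confirm that the components above satisfy, and are uniquely
  determined by, the dissection identity.
\<close>

definition q_cubed :: "laurent \<Rightarrow> laurent" where
  "q_cubed f = (\<Sum>i\<in>Poly_Mapping.keys f. Poly_Mapping.single (3 * i) (Poly_Mapping.lookup f i))"

lemma lookup_residue_part:
  "Poly_Mapping.lookup (residue_part r f) j = Poly_Mapping.lookup f (3 * j + r)"
  unfolding residue_part_def by (subst map_key.rep_eq) (auto simp: inj_on_def)

lemma lookup_q_cubed:
  "Poly_Mapping.lookup (q_cubed f) i = (if i mod 3 = 0 then Poly_Mapping.lookup f (i div 3) else 0)"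
proof -
  have "Poly_Mapping.lookup (q_cubed f) i =
      (\<Sum>k\<in>Poly_Mapping.keys f. if 3 * k = i then Poly_Mapping.lookup f k else 0)"
    by (auto simp: q_cubed_def lookup_sum lookup_single when_def intro!: sum.cong)
  also have "\<dots> = (if i mod 3 = 0 then Poly_Mapping.lookup f (i div 3) else 0)"
  proof (cases "i mod 3 = 0")
    case True
    then have "(3 * k = i) = (k = i div 3)" for k by presburger
    then show ?thesis using True by (simp add: in_keys_iff)
  next
    case False
    then have "3 * k \<noteq> i" for k by presburger
    then show ?thesis using False by simp
  qed
  finally show ?thesis .
qed

lemma lookup_shift:
  fixes f :: laurent
  shows "Poly_Mapping.lookup (Poly_Mapping.single r 1 * f) i = Poly_Mapping.lookup f (i - r)"
proof -
  have *: "f = (\<Sum>k\<in>Poly_Mapping.keys f. Poly_Mapping.single k (Poly_Mapping.lookup f k))"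
    by (rule poly_mapping_eqI)
       (simp add: lookup_sum lookup_single when_def in_keys_iff)
  have "Poly_Mapping.lookup (Poly_Mapping.single r 1 * f) i =
      (\<Sum>k\<in>Poly_Mapping.keys f. if k = i - r then Poly_Mapping.lookup f k else 0)"
    by (subst *) (auto simp: sum_distrib_left mult_single lookup_sum lookup_single when_def
        eq_diff_eq add.commute intro!: sum.cong)
  then show ?thesis by (simp add: in_keys_iff)
qed

theorem three_dissection_unique:
  "f = q_cubed a - Poly_Mapping.single 1 1 * q_cubed b - Poly_Mapping.single 2 1 * q_cubed c
   \<longleftrightarrow> a = residue_part 0 f \<and> b = - residue_part 1 f \<and> c = - residue_part 2 f"
  (is "?L \<longleftrightarrow> ?R")
proof
  assume ?L
  then have "Poly_Mapping.lookup f i =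
      Poly_Mapping.lookup (q_cubed a) i - Poly_Mapping.lookup (q_cubed b) (i - 1)
      - Poly_Mapping.lookup (q_cubed c) (i - 2)" for i
    by (simp add: lookup_minus lookup_shift)
  note L = this[unfolded lookup_q_cubed]
  have m: "(3 * j + 1) mod 3 = (1::int)" "(3 * j + 2) mod 3 = (2::int)"
    "(3 * j - 1) mod 3 = (2::int)" "(3 * j - 2) mod 3 = (1::int)"
    "(3 * j + 1 - 2) mod 3 = (2::int)"
    "(3 * j + 2 - 1) mod 3 = (1::int)" for j
    by presburger+
  show ?R
    by (intro conjI poly_mapping_eqI) (simp_all add: lookup_residue_part L m)
next
  assume ?R
  have "Poly_Mapping.lookup f i =
      Poly_Mapping.lookup (q_cubed a) i - Poly_Mapping.lookup (q_cubed b) (i - 1)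
      - Poly_Mapping.lookup (q_cubed c) (i - 2)" for i
  proof -
    have "i mod 3 = 0 \<or> i mod 3 = 1 \<or> i mod 3 = 2" by presburger
    then consider "i mod 3 = 0" | "i mod 3 = 1" | "i mod 3 = 2" by blast
    then show ?thesis
    proof cases
      case 1
      then have "(i - 1) mod 3 = 2" "(i - 2) mod 3 = 1" "3 * (i div 3) = i" by presburger+
      with 1 \<open>?R\<close> show ?thesis by (simp add: lookup_q_cubed lookup_residue_part)
    next
      case 2
      then have "(i - 1) mod 3 = 0" "(i - 2) mod 3 = 2" "3 * ((i - 1) div 3) + 1 = i"
        by presburger+
      with 2 \<open>?R\<close> show ?thesis by (simp add: lookup_q_cubed lookup_residue_part)
    next
      case 3
      then have "(i - 1) mod 3 = 1" "(i - 2) mod 3 = 0" "3 * ((i - 2) div 3) + 2 = i"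
        by presburger+
      with 3 \<open>?R\<close> show ?thesis by (simp add: lookup_q_cubed lookup_residue_part)
    qed
  qed
  then show ?L
    by (intro poly_mapping_eqI) (simp add: lookup_minus lookup_shift)
qed

lemma coeff_pX_sum:
  "poly.coeff (\<Sum>k=0..N. pX ^ k * [:c k:]) i = (if i \<le> N then c i else 0)"
proof -
  have "pX ^ k * [:c k:] = monom (c k) k" for k
    by (simp add: pX_def monom_altdef mult.commute)
  then show ?thesis by (simp add: coeff_sum)
qed

lemma degree_qpoch_qX: "Polynomial.degree (qpoch (pX ^ j * qX a) (qX b) n) \<le> j * n"
proof -
  have dX: "Polynomial.degree (qX x) = 0" for x by (simp add: qX_def)
  have 1: "Polynomial.degree (1 - pX ^ j * qX a * qX b ^ k) \<le> j" for k
  proof -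
    have "Polynomial.degree (qX b ^ k) = 0"
      using degree_power_le[of "qX b" k] by (simp add: dX)
    moreover have "Polynomial.degree (pX ^ j) \<le> j"
      using degree_power_le[of pX j] by (simp add: pX_def)
    ultimately have "Polynomial.degree (pX ^ j * qX a * qX b ^ k) \<le> j"
      using degree_mult_le[of "pX ^ j * qX a" "qX b ^ k"] degree_mult_le[of "pX ^ j" "qX a"] dX[of a]
      by linarith
    then show ?thesis using degree_diff_le[of 1 j] by simp
  qed
  have "Polynomial.degree (qpoch (pX ^ j * qX a) (qX b) n) \<le>
      (\<Sum>k<n. Polynomial.degree (1 - pX ^ j * qX a * qX b ^ k))"
    unfolding qpoch_def using degree_prod_sum_le[of "{..<n}"] by (simp add: o_def)
  also have "\<dots> \<le> (\<Sum>k<n. j)" by (rule sum_mono) (rule 1)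
  finally show ?thesis by (simp add: mult.commute)
qed

lemma degree_F_prod: "Polynomial.degree (F_prod m n) \<le> 2 * m * (m + 1) * n"
proof -
  have z: "Polynomial.degree (qpoch (qX a) (qX b) n) = 0" for a b
    using degree_qpoch_qX[of 0 a b n] by simp
  let ?f = "\<lambda>j. qpoch (pX ^ j * qX 1) (qX 3) n * qpoch (pX ^ j * qX 2) (qX 3) n *
        (qpoch (pX ^ j * qX (-1)) (qX (-3)) n * qpoch (pX ^ j * qX (-2)) (qX (-3)) n)"
  have f: "Polynomial.degree (?f j) \<le> 4 * n * j" for j
  proof -
    have "Polynomial.degree (?f j) \<le> (j * n + j * n) + (j * n + j * n)"
      by (intro order.trans[OF degree_mult_le] add_mono degree_qpoch_qX)
    then show ?thesis by (simp add: algebra_simps)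
  qed
  have "Polynomial.degree (\<Prod>j=1..m. ?f j) \<le> (\<Sum>j=1..m. Polynomial.degree (?f j))"
    using degree_prod_sum_le[of "{1..m}" ?f] by (simp add: o_def)
  also have "\<dots> \<le> (\<Sum>j=1..m. 4 * n * j)" by (rule sum_mono) (rule f)
  also have "\<dots> = 2 * m * (m + 1) * n" by (induction m) (auto simp: algebra_simps)
  finally have p: "Polynomial.degree (\<Prod>j=1..m. ?f j) \<le> 2 * m * (m + 1) * n" .
  have "Polynomial.degree (F_prod m n) \<le> 0 + 0 + 2 * m * (m + 1) * n"
    unfolding F_prod_def
    by (intro order.trans[OF degree_mult_le] add_mono p) (simp_all add: z)
  then show ?thesis by simp
qed

theorem F_prod_dissection:
  "F_prod m n = map_poly q_cubed (F0 m n) - qX 1 * map_poly q_cubed (F1 m n)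
                - qX 2 * map_poly q_cubed (F2 m n)"
proof (rule poly_eqI)
  fix k
  have [simp]: "q_cubed 0 = 0" by (simp add: q_cubed_def)
  note coeffs = F0_def F1_def F2_def coeff_pX_sum
  have 0: "poly.coeff (F0 m n) k = (if k \<le> 2 * m * (m + 1) * n then A_coeff m n k else 0)"
    and 1: "poly.coeff (F1 m n) k = (if k \<le> 2 * m * (m + 1) * n then B_coeff m n k else 0)"
    and 2: "poly.coeff (F2 m n) k = (if k \<le> 2 * m * (m + 1) * n then C_coeff m n k else 0)"
    unfolding coeffs by (rule refl)+
  show "poly.coeff (F_prod m n) k = poly.coeff (map_poly q_cubed (F0 m n)
      - qX 1 * map_poly q_cubed (F1 m n) - qX 2 * map_poly q_cubed (F2 m n)) k"
  proof (cases "k \<le> 2 * m * (m + 1) * n")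
    case True
    have "poly.coeff (F_prod m n) k = q_cubed (A_coeff m n k)
        - Poly_Mapping.single 1 1 * q_cubed (B_coeff m n k)
        - Poly_Mapping.single 2 1 * q_cubed (C_coeff m n k)"
      by (subst three_dissection_unique) (simp add: A_coeff_def B_coeff_def C_coeff_def)
    with True show ?thesis
      by (simp add: 0 1 2 coeff_map_poly qX_def)
  next
    case False
    then have "poly.coeff (F_prod m n) k = 0"
      using degree_F_prod[of m n] by (intro coeff_eq_0) linarith
    with False show ?thesis
      by (simp add: 0 1 2 coeff_map_poly qX_def)
  qed
qed

end

theory Submission
  imports Defs
begin

text \<open>
  Write \<open>t = p\<close>, \<open>N = 2m + 1\<close> and \<open>M = 2n\<close>. At \<open>(w, w t, \<dots>, w t\<^sup>N\<^sup>-\<^sup>1)\<close> a Macdonald polynomial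
  of type \<open>A\<close> is an explicit product, so the \<open>q\<close>-binomial theorem of Kaneko and Macdonald becomes
  a statement without symmetric functions: for partitions \<open>\<lambda>\<close> inside an \<open>N \<times> M\<close> box,
  \<open>\<Sum>\<^sub>\<lambda> T\<^sub>M(\<lambda>) w\<^bsup>|\<lambda>|\<^esup> = \<Prod>\<^sub>i\<^sub><\<^sub>N (t\<^sup>i w; q)\<^sub>M\<close> with a product \<open>T\<^sub>M(\<lambda>)\<close>. This is
  \<open>kaneko_binomial\<close>, and the sum in the dissection is this sum, with the partitions
  shifted by \<open>n\<close>, cut into three parts according to \<open>|\<lambda>|\<close> modulo \<open>3\<close>.

  The binomial theorem follows by induction on \<open>M\<close>. Passing from \<open>M\<close> to \<open>M + 1\<close> multiplies the
  right-hand side by \<open>\<Prod>\<^sub>i (1 - t\<^sup>i q\<^sup>M w)\<close>. At a partition \<open>\<mu>\<close> this factor is expanded as a sum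
  over sets \<open>I\<close> of rows, which is the Pieri rule for vertical strips at the special
  point; the summand of \<open>I\<close> is attached to the partition \<open>\<mu> + 1\<^sub>I\<close>. After collecting the
  contributions to a fixed \<open>\<lambda>\<close> the claim is again a sum over sets \<open>I\<close>. So two identities are
  needed, in the \<open>N\<close> points \<open>q\<^bsup>\<lambda>(i)\<^esup> t\<^sup>N\<^sup>-\<^sup>i\<close>: \<open>strip_sum_const\<close> for the expansion and
  \<open>strip_sum_linear\<close> for the collection. Both hold for arbitrary distinct points (nonzero ones
  for the first), since as a function of one point each side has no poles and a degree
  so small that one or two special values determine it; there the identity reduces
  to one point fewer.

  For the dissection take \<open>q\<^sup>3\<close> for \<open>q\<close> and \<open>w = p\<^sup>-\<^sup>m q\<^sup>2\<^sup>-\<^sup>3\<^sup>n\<close>. The product on the right then is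
  \<open>F\<^sub>m\<^sub>,\<^sub>n(p, q)\<close> up to a monomial (\<open>prod_gen_factors\<close>). On the left the coefficient of \<open>w\<^sup>c\<close>, the sum
  of \<open>T\<^sub>M(\<lambda>)\<close> over \<open>|\<lambda>| = c\<close>, is a polynomial in \<open>p\<close> and \<open>q\<^sup>3\<close>, although single summands are only
  rational functions. Hence the \<open>q\<close>-exponents of the \<open>c\<close>-th term all lie in one
  residue class modulo \<open>3\<close>, which depends on \<open>c\<close> only, and picking a class of exponents
  means picking a class of \<open>|\<lambda>|\<close>.
\<close>


section \<open>Two rational function identities summed over subsets of points\<close>

text \<open>
  With the \<open>x\<^sub>a\<close> in place of the variables, \<open>strip_weight t x A I\<close> is the coefficient of the \<open>q\<close>-shift of
  the variables in \<open>I\<close> in Macdonald's operator \<open>D\<^sub>r\<close>, \<open>r = |I|\<close>, up to replacing \<open>x\<close> by \<open>1 / x\<close>.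
\<close>

definition strip_weight :: "'a::field \<Rightarrow> ('b \<Rightarrow> 'a) \<Rightarrow> 'b set \<Rightarrow> 'b set \<Rightarrow> 'a" where
  "strip_weight t x A I =
     t ^ (card I choose 2) * (\<Prod>a\<in>I. \<Prod>b\<in>A - I. (x a - t * x b) / (x a - x b))"

text \<open>
  Taking \<open>f\<close> and \<open>g\<close> as polynomials, rather than functions, makes the sum a rational function of each
  point, so that values of one point can determine it.
\<close>

definition strip_sum :: "'a::field \<Rightarrow> ('b \<Rightarrow> 'a) \<Rightarrow> 'a poly \<Rightarrow> 'a poly \<Rightarrow> 'b set \<Rightarrow> 'a" where
  "strip_sum t x f g A =
     (\<Sum>I\<in>Pow A. strip_weight t x A I * (\<Prod>a\<in>I. poly f (x a)) * (\<Prod>b\<in>A - I. poly g (x b)))"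

lemma choose_two_Suc: "Suc r choose 2 = (r choose 2) + r"
  by (simp add: numeral_2_eq_2)

lemma strip_weight_insert_out:
  assumes "finite A" "k \<notin> A" "I \<subseteq> A"
  shows "strip_weight t x (insert k A) I =
    strip_weight t x A I * (\<Prod>a\<in>I. (x a - t * x k) / (x a - x k))"
proof -
  have "insert k A - I = insert k (A - I)" using assms by auto
  then show ?thesis
    using assms finite_subset[OF \<open>I \<subseteq> A\<close>]
    by (simp add: strip_weight_def prod.distrib mult_ac times_divide_eq_right[symmetric] del: times_divide_eq_right times_divide_eq_left)
qed

lemma strip_weight_insert_in:
  assumes "finite A" "k \<notin> A" "I \<subseteq> A"
  shows "strip_weight t x (insert k A) (insert k I) =
    strip_weight t x A I * t ^ card I * (\<Prod>b\<in>A - I. (x k - t * x b) / (x k - x b))"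
proof -
  have "insert k A - insert k I = A - I" "k \<notin> I" using assms by auto
  then show ?thesis
    using assms finite_subset[OF \<open>I \<subseteq> A\<close>]
    by (simp add: strip_weight_def choose_two_Suc power_add mult_ac)
qed

text \<open>
  Sorting the subsets by whether they contain \<open>k\<close> shows the dependence on the single point \<open>x\<^sub>k\<close>, which
  occurs in the last bracket only.
\<close>

lemma strip_sum_insert:
  assumes A: "finite A" "k \<notin> A"
  shows "strip_sum t x f g (insert k A) =
    (\<Sum>I\<in>Pow A. strip_weight t x A I * (\<Prod>a\<in>I. poly f (x a)) * (\<Prod>b\<in>A - I. poly g (x b)) *
       (poly g (x k) * (\<Prod>a\<in>I. (x a - t * x k) / (x a - x k)) +
        poly f (x k) * t ^ card I * (\<Prod>b\<in>A - I. (x k - t * x b) / (x k - x b))))"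
    (is "_ = ?R")
proof -
  let ?h = "\<lambda>I. strip_weight t x (insert k A) I * (\<Prod>a\<in>I. poly f (x a)) *
    (\<Prod>b\<in>insert k A - I. poly g (x b))"
  have inj: "inj_on (insert k) (Pow A)" using A by (auto simp: inj_on_def)
  have "strip_sum t x f g (insert k A) = (\<Sum>I\<in>Pow A. ?h I) + (\<Sum>I\<in>Pow A. ?h (insert k I))"
    unfolding strip_sum_def Pow_insert
    using A by (subst sum.union_disjoint) (auto simp: sum.reindex[OF inj])
  also have "\<dots> = ?R"
    unfolding sum.distrib[symmetric]
  proof (rule sum.cong, rule refl)
    fix I assume "I \<in> Pow A"
    then have I: "I \<subseteq> A" "finite I" "k \<notin> I" using A by (auto intro: finite_subset)
    have *: "insert k A - I = insert k (A - I)" "insert k A - insert k I = A - I"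
      using I A by auto
    show "?h I + ?h (insert k I) = strip_weight t x A I * (\<Prod>a\<in>I. poly f (x a)) *
       (\<Prod>b\<in>A - I. poly g (x b)) *
       (poly g (x k) * (\<Prod>a\<in>I. (x a - t * x k) / (x a - x k)) +
        poly f (x k) * t ^ card I * (\<Prod>b\<in>A - I. (x k - t * x b) / (x k - x b)))"
      unfolding strip_weight_insert_out[OF A I(1)] strip_weight_insert_in[OF A I(1)]
      using I A by (simp add: * algebra_simps)
  qed
  finally show ?thesis .
qed

text \<open>
  The sum over the subsets of \<open>insert k A\<close> as a function of \<open>z = x\<^sub>k\<close>, multiplied by the common
  denominator \<open>\<Prod>\<^sub>a\<^sub>\<in>\<^sub>A (z - x\<^sub>a)\<close>.
\<close>

definition cleared_poly ::
  "'a::field \<Rightarrow> ('b \<Rightarrow> 'a) \<Rightarrow> 'a poly \<Rightarrow> 'a poly \<Rightarrow> 'b set \<Rightarrow> 'a poly" where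
  "cleared_poly t x f g A =
    (\<Sum>I\<in>Pow A. smult (strip_weight t x A I * (\<Prod>a\<in>I. poly f (x a)) * (\<Prod>b\<in>A - I. poly g (x b)))
       (g * ((\<Prod>a\<in>I. [:- x a, t:]) * (\<Prod>b\<in>A - I. [:- x b, 1:])) +
        smult (t ^ card I) (f * ((\<Prod>a\<in>I. [:- x a, 1:]) * (\<Prod>b\<in>A - I. [:- t * x b, 1:])))))"

lemma cleared_poly_cong:
  fixes t :: "'a::field" and x y :: "'b \<Rightarrow> 'a"
  assumes "\<And>a. a \<in> A \<Longrightarrow> x a = y a"
  shows "cleared_poly t x f g A = cleared_poly t y f g A"
  unfolding cleared_poly_def strip_weight_def
proof (rule sum.cong, rule refl)
  fix I assume "I \<in> Pow A"
  then have *: "x a = y a" if "a \<in> I \<or> a \<in> A - I" for a using that assms by auto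
  have **: "(\<Prod>a\<in>I. h (x a)) = (\<Prod>a\<in>I. h (y a))" "(\<Prod>b\<in>A - I. h (x b)) = (\<Prod>b\<in>A - I. h (y b))"
    for h :: "'a \<Rightarrow> 'c::comm_monoid_mult"
    using * by (auto intro!: prod.cong)
  have w: "(\<Prod>a\<in>I. \<Prod>b\<in>A - I. (x a - t * x b) / (x a - x b)) =
      (\<Prod>a\<in>I. \<Prod>b\<in>A - I. (y a - t * y b) / (y a - y b))"
    using * by (intro prod.cong) auto
  show "smult (t ^ (card I choose 2) * (\<Prod>a\<in>I. \<Prod>b\<in>A - I. (x a - t * x b) / (x a - x b)) *
        (\<Prod>a\<in>I. poly f (x a)) * (\<Prod>b\<in>A - I. poly g (x b)))
       (g * ((\<Prod>a\<in>I. [:- x a, t:]) * (\<Prod>b\<in>A - I. [:- x b, 1:])) +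
        smult (t ^ card I) (f * ((\<Prod>a\<in>I. [:- x a, 1:]) * (\<Prod>b\<in>A - I. [:- t * x b, 1:])))) =
      smult (t ^ (card I choose 2) * (\<Prod>a\<in>I. \<Prod>b\<in>A - I. (y a - t * y b) / (y a - y b)) *
        (\<Prod>a\<in>I. poly f (y a)) * (\<Prod>b\<in>A - I. poly g (y b)))
       (g * ((\<Prod>a\<in>I. [:- y a, t:]) * (\<Prod>b\<in>A - I. [:- y b, 1:])) +
        smult (t ^ card I) (f * ((\<Prod>a\<in>I. [:- y a, 1:]) * (\<Prod>b\<in>A - I. [:- t * y b, 1:]))))"
    unfolding w using **(1)[of "poly f"] **(2)[of "poly g"] **(1)[of "\<lambda>z. [:- z, t:]"]
      **(1)[of "\<lambda>z. [:- z, 1:]"] **(2)[of "\<lambda>z. [:- z, 1:]"] **(2)[of "\<lambda>z. [:- t * z, 1:]"]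
    by (simp only:)
qed

lemma strip_sum_insert_cleared:
  assumes A: "finite A" "k \<notin> A" and k: "x k \<notin> x ` A"
  shows "strip_sum t x f g (insert k A) * (\<Prod>a\<in>A. x k - x a) = poly (cleared_poly t x f g A) (x k)"
  unfolding strip_sum_insert[OF A] cleared_poly_def poly_sum sum_distrib_right
proof (rule sum.cong, rule refl)
  fix I assume "I \<in> Pow A"
  then have I: "I \<subseteq> A" "finite I" using A by (auto intro: finite_subset)
  have nz: "x a - x k \<noteq> 0" "x k - x a \<noteq> 0" if "a \<in> A" for a
    using k imageI[OF that, of x] by auto
  have D: "(\<Prod>a\<in>A. x k - x a) = (\<Prod>a\<in>I. x k - x a) * (\<Prod>b\<in>A - I. x k - x b)"
    using prod.subset_diff[OF I(1) A(1), of "\<lambda>a. x k - x a"] by (simp add: mult.commute)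
  have 1: "(\<Prod>a\<in>I. (x a - t * x k) / (x a - x k)) * (\<Prod>a\<in>I. x k - x a) =
     (\<Prod>a\<in>I. t * x k - x a)"
    unfolding prod.distrib[symmetric]
    using I nz by (intro prod.cong) (auto simp: divide_simps, auto simp: algebra_simps)
  have 2: "(\<Prod>b\<in>A - I. (x k - t * x b) / (x k - x b)) * (\<Prod>b\<in>A - I. x k - x b) =
     (\<Prod>b\<in>A - I. x k - t * x b)"
    unfolding prod.distrib[symmetric]
    using I nz by (intro prod.cong) (auto simp: divide_simps)
  let ?w = "strip_weight t x A I * (\<Prod>a\<in>I. poly f (x a)) * (\<Prod>b\<in>A - I. poly g (x b))"
  have "?w * (poly g (x k) * (\<Prod>a\<in>I. (x a - t * x k) / (x a - x k)) +
        poly f (x k) * t ^ card I * (\<Prod>b\<in>A - I. (x k - t * x b) / (x k - x b))) * (\<Prod>a\<in>A. x k - x a)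
     = ?w * (poly g (x k) * ((\<Prod>a\<in>I. (x a - t * x k) / (x a - x k)) * (\<Prod>a\<in>I. x k - x a)) *
          (\<Prod>b\<in>A - I. x k - x b) +
        poly f (x k) * t ^ card I * ((\<Prod>b\<in>A - I. (x k - t * x b) / (x k - x b)) *
          (\<Prod>b\<in>A - I. x k - x b)) * (\<Prod>a\<in>I. x k - x a))"
    unfolding D by (simp add: algebra_simps)
  also have "\<dots> = poly (smult ?w (g * ((\<Prod>a\<in>I. [:- x a, t:]) * (\<Prod>b\<in>A - I. [:- x b, 1:])) +
        smult (t ^ card I) (f * ((\<Prod>a\<in>I. [:- x a, 1:]) * (\<Prod>b\<in>A - I. [:- t * x b, 1:]))))) (x k)"
    unfolding 1 2 by (simp add: poly_prod algebra_simps)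
  finally show "?w * (poly g (x k) * (\<Prod>a\<in>I. (x a - t * x k) / (x a - x k)) +
        poly f (x k) * t ^ card I * (\<Prod>b\<in>A - I. (x k - t * x b) / (x k - x b))) * (\<Prod>a\<in>A. x k - x a)
     = \<dots>" .
qed

text \<open>
  The sum has no pole at \<open>z = x\<^sub>k\<close> for \<open>k \<in> A\<close>. Only the subsets that contain exactly one of \<open>k\<close> and
  the new index have a pole there; exchanging the two indices pairs these subsets up, and the
  residues in a pair are opposite.
\<close>

lemma poly_cleared_poly_node:
  assumes A: "finite A" "inj_on x A" and k: "k \<in> A"
  shows "poly (cleared_poly t x f g A) (x k) = 0"
proof -
  define B where "B = A - {k}"
  have B: "finite B" "k \<notin> B" "A = insert k B" using A k by (auto simp: B_def)
  have nz: "x a - x k \<noteq> 0" "x k - x a \<noteq> 0" if "a \<in> B" for a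
    using A(2) that B by (auto simp: inj_on_def)
  have inj: "inj_on (insert k) (Pow B)" using B by (auto simp: inj_on_def)
  let ?w = "\<lambda>I. strip_weight t x A I * (\<Prod>a\<in>I. poly f (x a)) * (\<Prod>b\<in>A - I. poly g (x b))"
  let ?h = "\<lambda>I. ?w I *
       (poly g (x k) * ((\<Prod>a\<in>I. t * x k - x a) * (\<Prod>b\<in>A - I. x k - x b)) +
        t ^ card I * (poly f (x k) * ((\<Prod>a\<in>I. x k - x a) * (\<Prod>b\<in>A - I. x k - t * x b))))"
  have "poly (cleared_poly t x f g A) (x k) = (\<Sum>I\<in>Pow A. ?h I)"
    by (simp add: cleared_poly_def poly_sum poly_prod algebra_simps)
  also have "\<dots> = (\<Sum>I\<in>Pow B. ?h I) + (\<Sum>I\<in>Pow B. ?h (insert k I))"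
    using B unfolding B(3) Pow_insert
    by (subst sum.union_disjoint) (auto simp: sum.reindex[OF inj])
  also have "\<dots> = (\<Sum>I\<in>Pow B. ?h I + ?h (insert k I))"
    by (rule sum.distrib[symmetric])
  also have "\<dots> = 0"
  proof (intro sum.neutral ballI)
    fix I assume "I \<in> Pow B"
    then have I: "I \<subseteq> B" "finite I" "k \<notin> I" using B by (auto intro: finite_subset)
    have *: "A - I = insert k (B - I)" "A - insert k I = B - I" using I B by auto
    have f: "finite (B - I)" "k \<notin> B - I" using B by auto
    let ?C = "strip_weight t x B I * (\<Prod>a\<in>I. poly f (x a)) * (\<Prod>b\<in>B - I. poly g (x b)) * t ^ card I *
      poly f (x k) * poly g (x k)"
    have 1: "(\<Prod>a\<in>I. (x a - t * x k) / (x a - x k)) * (\<Prod>a\<in>I. x k - x a) =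
       (\<Prod>a\<in>I. t * x k - x a)"
      unfolding prod.distrib[symmetric]
      using I nz by (intro prod.cong) (auto simp: divide_simps, auto simp: algebra_simps)
    have 2: "(\<Prod>b\<in>B - I. (x k - t * x b) / (x k - x b)) * (\<Prod>b\<in>B - I. x k - x b) =
       (\<Prod>b\<in>B - I. x k - t * x b)"
      unfolding prod.distrib[symmetric]
      using I nz by (intro prod.cong) (auto simp: divide_simps)
    have e1: "?h I = ?C * (\<Prod>a\<in>I. t * x k - x a) * (x k - t * x k) * (\<Prod>b\<in>B - I. x k - t * x b)"
      unfolding 1[symmetric] B(3) strip_weight_insert_out[OF B(1,2) I(1)]
      unfolding B(3)[symmetric] *
      using f by (simp add: mult_ac)
    have e2: "?h (insert k I) =
       ?C * (\<Prod>b\<in>B - I. x k - t * x b) * (t * x k - x k) * (\<Prod>a\<in>I. t * x k - x a)"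
      unfolding 2[symmetric] B(3) strip_weight_insert_in[OF B(1,2) I(1)]
      unfolding B(3)[symmetric] *
      using I by (simp add: mult_ac)
    show "?h I + ?h (insert k I) = 0"
      unfolding e1 e2 by (simp add: algebra_simps)
  qed
  finally show ?thesis .
qed

lemma degree_prod_linear_le:
  fixes u v :: "'b \<Rightarrow> 'a::comm_ring_1"
  assumes "finite S"
  shows "degree (\<Prod>a\<in>S. [:u a, v a:]) \<le> card S"
proof -
  have "degree (\<Prod>a\<in>S. [:u a, v a:]) \<le> (\<Sum>a\<in>S. degree [:u a, v a:])"
    using degree_prod_sum_le[OF assms, of "\<lambda>a. [:u a, v a:]"] by (simp add: o_def)
  also have "\<dots> \<le> (\<Sum>a\<in>S. 1)" by (rule sum_mono) simp
  finally show ?thesis by simp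
qed

lemma degree_cleared_poly:
  fixes t :: "'a::field"
  assumes A: "finite A" and fg: "degree f \<le> d" "degree g \<le> d"
  shows "degree (cleared_poly t x f g A) \<le> card A + d"
  unfolding cleared_poly_def
proof (rule degree_sum_le)
  show "finite (Pow A)" using A by simp
next
  fix I assume "I \<in> Pow A"
  then have I: "I \<subseteq> A" "finite I" "finite (A - I)" using A by (auto intro: finite_subset)
  have c: "card A = card I + card (A - I)"
    using I A by (simp add: card_Diff_subset card_mono)
  have p: "degree (h * ((\<Prod>a\<in>I. [:- x a, u:]) * (\<Prod>b\<in>A - I. [:v * x b, 1:]))) \<le> card A + d"
    if "degree h \<le> d" for h :: "'a poly" and u v
    unfolding c
    using order.trans[OF degree_mult_le add_mono[OF that order.trans[OF degree_mult_le
        add_mono[OF degree_prod_linear_le[OF I(2)] degree_prod_linear_le[OF I(3)]]]]]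
    by (simp add: add_ac)
  show "degree (smult (strip_weight t x A I * (\<Prod>a\<in>I. poly f (x a)) * (\<Prod>b\<in>A - I. poly g (x b)))
       (g * ((\<Prod>a\<in>I. [:- x a, t:]) * (\<Prod>b\<in>A - I. [:- x b, 1:])) +
        smult (t ^ card I) (f * ((\<Prod>a\<in>I. [:- x a, 1:]) * (\<Prod>b\<in>A - I. [:- t * x b, 1:])))))
     \<le> card A + d"
    using p[OF fg(2), of t "-1"] p[OF fg(1), of 1 "-t"]
    by (intro order.trans[OF degree_smult_le] degree_add_le) auto
qed

text \<open>
  As a function of one point \<open>z\<close> the sum has no poles and is bounded at infinity, so it is constant and
  may be evaluated at \<open>z = 0\<close>. There each subset of the remaining points contributes the same factor
  \<open>1 - u t\<^bsup>|A|\<^esup>\<close>.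
\<close>

theorem strip_sum_const:
  assumes "finite A" "inj_on x A" "0 \<notin> x ` A"
  shows "strip_sum t x [:- u:] 1 A = (\<Prod>i<card A. 1 - u * t ^ i)"
  using assms
proof (induction A rule: finite_induct)
  case empty
  show ?case by (simp add: strip_sum_def strip_weight_def numeral_2_eq_2)
next
  case (insert k A)
  let ?P = "cleared_poly t x [:- u:] 1 A"
  define R where "R = smult (\<Prod>i<Suc (card A). 1 - u * t ^ i) (\<Prod>a\<in>A. [:- x a, 1:])"
  have IH: "strip_sum t x [:- u:] 1 A = (\<Prod>i<card A. 1 - u * t ^ i)"
    using insert by auto
  have k: "x k \<notin> x ` A" using insert by auto
  have inj: "inj_on x A" using insert by auto
  have eq: "?P = R"
  proof (rule poly_eqI_degree)
    fix z assume z: "z \<in> insert 0 (x ` A)"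
    show "poly ?P z = poly R z"
    proof (cases "z = 0")
      case True
      have "poly ?P 0 = (\<Sum>I\<in>Pow A. strip_weight t x A I * (- u) ^ card I *
          ((\<Prod>a\<in>A. - x a) * (1 - u * t ^ card A)))"
        unfolding cleared_poly_def poly_sum
      proof (rule sum.cong, rule refl)
        fix I assume "I \<in> Pow A"
        then have I: "I \<subseteq> A" "finite I" "finite (A - I)"
          using insert.hyps by (auto intro: finite_subset)
        have D: "(\<Prod>a\<in>A. - x a) = (\<Prod>a\<in>I. - x a) * (\<Prod>a\<in>A - I. - x a)"
          using prod.subset_diff[OF I(1) insert.hyps(1), of "\<lambda>a. - x a"] by (simp add: mult.commute)
        have "card A = card I + card (A - I)"
          using I insert.hyps by (simp add: card_Diff_subset card_mono)
        then have T: "t ^ card A = t ^ card I * t ^ card (A - I)" by (simp add: power_add)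
        have 2: "(\<Prod>b\<in>A - I. - (t * x b)) = t ^ card (A - I) * (\<Prod>a\<in>A - I. - x a)"
          by (subst prod_constant[symmetric], subst prod.distrib[symmetric]) simp
        show "poly (smult (strip_weight t x A I * (\<Prod>a\<in>I. poly [:- u:] (x a)) *
              (\<Prod>b\<in>A - I. poly 1 (x b)))
           (1 * ((\<Prod>a\<in>I. [:- x a, t:]) * (\<Prod>b\<in>A - I. [:- x b, 1:])) +
            smult (t ^ card I) ([:- u:] * ((\<Prod>a\<in>I. [:- x a, 1:]) * (\<Prod>b\<in>A - I. [:- t * x b, 1:])))))
             0 = strip_weight t x A I * (- u) ^ card I * ((\<Prod>a\<in>A. - x a) * (1 - u * t ^ card A))"
          using 2 by (simp add: poly_prod D T algebra_simps)
      qed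
      also have "\<dots> = strip_sum t x [:- u:] 1 A * ((\<Prod>a\<in>A. - x a) * (1 - u * t ^ card A))"
        by (simp add: strip_sum_def sum_distrib_right)
      finally show ?thesis unfolding True IH by (simp add: R_def poly_prod mult_ac)
    next
      case False
      then obtain a where a: "a \<in> A" "z = x a" using z by auto
      then have "poly R z = 0" using insert.hyps by (auto simp: R_def poly_prod)
      then show ?thesis using poly_cleared_poly_node[OF insert.hyps(1) inj a(1)] a by simp
    qed
  next
    have "card (x ` A) = card A" "0 \<notin> x ` A" using inj insert.prems by (auto simp: card_image)
    then have c: "card (insert 0 (x ` A)) = Suc (card A)" using insert.hyps by simp
    show "degree ?P < card (insert 0 (x ` A))"
      using degree_cleared_poly[OF insert.hyps(1), of "[:-u:]" 0 1 t x] c by simp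
    show "degree R < card (insert 0 (x ` A))"
      unfolding R_def c using degree_prod_linear_le[OF insert.hyps(1), of "\<lambda>a. - x a" "\<lambda>_. 1"]
      by (meson degree_smult_le le_imp_less_Suc order.trans)
  qed
  have "strip_sum t x [:- u:] 1 (insert k A) * (\<Prod>a\<in>A. x k - x a) =
      (\<Prod>i<Suc (card A). 1 - u * t ^ i) * (\<Prod>a\<in>A. x k - x a)"
    using strip_sum_insert_cleared[where k=k and x=x and A=A] insert.hyps k eq
    by (simp add: R_def poly_prod)
  moreover have "(\<Prod>a\<in>A. x k - x a) \<noteq> 0" using k insert.hyps by auto
  ultimately show ?case using insert.hyps by simp
qed

text \<open>
  If \<open>f\<close> vanishes at \<open>x\<^sub>k\<close>, only subsets without \<open>k\<close> count, and the factors that involve \<open>x\<^sub>k\<close> move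
  the zero of \<open>f\<close> from \<open>s\<close> to \<open>t s\<close>.
\<close>

lemma strip_sum_linear_insert_zero_in:
  assumes B: "finite B" "k \<notin> B" "x k \<notin> x ` B" and k: "x k = s"
  shows "strip_sum t x [:Q * s, - Q:] g (insert k B) =
    poly g s * strip_sum t x [:Q * (t * s), - Q:] g B"
  unfolding strip_sum_insert[OF B(1,2)] unfolding strip_sum_def sum_distrib_left k
proof (rule sum.cong, rule refl)
  fix I assume "I \<in> Pow B"
  then have I: "I \<subseteq> B" by simp
  have nz: "x a - s \<noteq> 0" if "a \<in> B" for a
    using B k imageI[OF that, of x] by auto
  have 1: "(\<Prod>a\<in>I. poly [:Q * s, - Q:] (x a)) * (\<Prod>a\<in>I. (x a - t * s) / (x a - s)) =
    (\<Prod>a\<in>I. poly [:Q * (t * s), - Q:] (x a))"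
    unfolding prod.distrib[symmetric]
    using I nz by (intro prod.cong) (auto simp: divide_simps, auto simp: algebra_simps)
  show "strip_weight t x B I * (\<Prod>a\<in>I. poly [:Q * s, - Q:] (x a)) * (\<Prod>b\<in>B - I. poly g (x b)) *
      (poly g s * (\<Prod>a\<in>I. (x a - t * s) / (x a - s)) +
       poly [:Q * s, - Q:] s * t ^ card I * (\<Prod>b\<in>B - I. (s - t * x b) / (s - x b))) =
    poly g s * (strip_weight t x B I * (\<Prod>a\<in>I. poly [:Q * (t * s), - Q:] (x a)) *
      (\<Prod>b\<in>B - I. poly g (x b)))"
    unfolding 1[symmetric] by simp
qed

text \<open>
  The mirror case: if \<open>g\<close> vanishes at \<open>x\<^sub>k\<close>, only subsets with \<open>k\<close> count, and the zero of \<open>g\<close> moves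
  from \<open>c t\<close> to \<open>c\<close>.
\<close>

lemma strip_sum_linear_insert_zero_out:
  assumes B: "finite B" "k \<notin> B" "x k \<notin> x ` B" and k: "x k = c * t"
  shows "strip_sum t x f [:- (c * t), 1:] (insert k B) =
    poly f (c * t) * t ^ card B * strip_sum t x f [:- c, 1:] B"
  unfolding strip_sum_insert[OF B(1,2)] unfolding strip_sum_def sum_distrib_left k
proof (rule sum.cong, rule refl)
  fix I assume "I \<in> Pow B"
  then have I: "I \<subseteq> B" "finite I" using B by (auto intro: finite_subset)
  have nz: "c * t - x a \<noteq> 0" if "a \<in> B" for a
    using B k imageI[OF that, of x] by auto
  have "card B = card I + card (B - I)"
    using I B by (simp add: card_Diff_subset card_mono)
  then have T: "t ^ card B = t ^ card I * t ^ card (B - I)" by (simp add: power_add)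
  have "(\<Prod>b\<in>B - I. poly [:- (c * t), 1:] (x b)) * (\<Prod>b\<in>B - I. (c * t - t * x b) / (c * t - x b)) =
    (\<Prod>b\<in>B - I. t * poly [:- c, 1:] (x b))"
    unfolding prod.distrib[symmetric]
    using I nz by (intro prod.cong) (auto simp: divide_simps, auto simp: algebra_simps)
  then have 1: "(\<Prod>b\<in>B - I. poly [:- (c * t), 1:] (x b)) *
      (\<Prod>b\<in>B - I. (c * t - t * x b) / (c * t - x b)) =
    t ^ card (B - I) * (\<Prod>b\<in>B - I. poly [:- c, 1:] (x b))"
    by (simp add: prod.distrib)
  have "strip_weight t x B I * (\<Prod>a\<in>I. poly f (x a)) * (\<Prod>b\<in>B - I. poly [:- (c * t), 1:] (x b)) *
      (poly [:- (c * t), 1:] (c * t) * (\<Prod>a\<in>I. (x a - t * (c * t)) / (x a - c * t)) +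
       poly f (c * t) * t ^ card I * (\<Prod>b\<in>B - I. (c * t - t * x b) / (c * t - x b))) =
    strip_weight t x B I * (\<Prod>a\<in>I. poly f (x a)) * poly f (c * t) * t ^ card I *
      ((\<Prod>b\<in>B - I. poly [:- (c * t), 1:] (x b)) *
      (\<Prod>b\<in>B - I. (c * t - t * x b) / (c * t - x b)))"
    by simp
  also have "\<dots> = poly f (c * t) * t ^ card B * (strip_weight t x B I * (\<Prod>a\<in>I. poly f (x a)) *
      (\<Prod>b\<in>B - I. poly [:- c, 1:] (x b)))"
    unfolding 1 T by (simp only: mult_ac)
  finally show "strip_weight t x B I * (\<Prod>a\<in>I. poly f (x a)) *
      (\<Prod>b\<in>B - I. poly [:- (c * t), 1:] (x b)) *
      (poly [:- (c * t), 1:] (c * t) * (\<Prod>a\<in>I. (x a - t * (c * t)) / (x a - c * t)) +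
       poly f (c * t) * t ^ card I * (\<Prod>b\<in>B - I. (c * t - t * x b) / (c * t - x b))) = \<dots>" .
qed

text \<open>
  Here \<open>f(z) = Q (s - z)\<close> and \<open>g(z) = z - c\<close>. As a function of one point the sum is a
  polynomial of degree at most one, hence determined by its values at the zeros \<open>s\<close> and \<open>c\<close> of
  \<open>f\<close> and \<open>g\<close>. At either zero the sum reduces to the same kind of sum with one point fewer, for the
  parameters \<open>t s, c\<close> or \<open>s, c / t\<close>. The relation between \<open>c\<close> and \<open>s\<close> is the one
  preserved by both reductions, and \<open>t\<^sup>i Q \<noteq> 1\<close> keeps \<open>s\<close> and \<open>c\<close> apart.
\<close>

theorem strip_sum_linear:
  fixes t Q s c :: "'a::field" and x :: "'b \<Rightarrow> 'a"
  assumes "finite A" "inj_on x A" "t \<noteq> 0" "s \<noteq> 0" "c * t = s * Q * t ^ card A"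
    and Q: "\<And>i. t ^ i * Q \<noteq> 1"
  shows "strip_sum t x [:Q * s, - Q:] [:- c, 1:] A = (\<Prod>a\<in>A. x a) * (\<Prod>i<card A. 1 - t ^ i * Q)"
  using assms(1,2,4,5)
proof (induction "card A" arbitrary: A s c x)
  case 0
  then show ?case by (simp add: strip_sum_def strip_weight_def numeral_2_eq_2)
next
  case (Suc n)
  note t0 = \<open>t \<noteq> 0\<close>
  have c: "c = s * Q * t ^ n"
    using Suc.prems(4) t0 by (simp flip: Suc.hyps(2))
  define c' where "c' = c / t"
  have c': "c = c' * t" using t0 by (simp add: c'_def)
  \<comment> \<open>The points are allowed to vary here, since the free point is later moved to s and to c.\<close>
  have node: "strip_sum t y [:Q * s, - Q:] [:- c, 1:] (insert k B) =
      (\<Prod>a\<in>insert k B. y a) * (\<Prod>i<Suc (card B). 1 - t ^ i * Q)"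
    if B: "k \<notin> B" "finite B" "inj_on y (insert k B)" "n = card B" and k: "y k = s \<or> y k = c"
    for k B and y :: "'b \<Rightarrow> 'a"
  proof -
    have yk: "y k \<notin> y ` B" using B by auto
    have inj: "inj_on y B" using B by auto
    from k show ?thesis
    proof
      assume k: "y k = s"
      have "strip_sum t y [:Q * (t * s), - Q:] [:- c, 1:] B =
          (\<Prod>a\<in>B. y a) * (\<Prod>i<card B. 1 - t ^ i * Q)"
        using Suc.prems t0 c by (intro Suc.hyps(1)[OF B(4,2) inj]) (auto simp: B(4))
      then show ?thesis
        unfolding strip_sum_linear_insert_zero_in[where x=y, OF B(2,1) yk k]
        using B k by (simp add: c algebra_simps)
    next
      assume k: "y k = c"
      have "strip_sum t y [:Q * s, - Q:] [:- c', 1:] B =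
          (\<Prod>a\<in>B. y a) * (\<Prod>i<card B. 1 - t ^ i * Q)"
        using Suc.prems t0 c c' by (intro Suc.hyps(1)[OF B(4,2) inj]) (auto simp: B(4))
      then show ?thesis
        unfolding c' strip_sum_linear_insert_zero_out[where x=y, OF B(2,1) yk k[unfolded c']]
        unfolding c'[symmetric] using B k by (simp add: c algebra_simps)
    qed
  qed
  show ?case
  \<comment> \<open>If some point already is s or c, the interpolation nodes below would not be distinct,
      but then the reduction applies directly to that point.\<close>
  proof (cases "\<exists>k\<in>A. x k = s \<or> x k = c")
    case True
    then obtain k where k: "k \<in> A" "x k = s \<or> x k = c" by blast
    have A: "A = insert k (A - {k})" "card (A - {k}) = n" using k Suc by auto
    have "strip_sum t x [:Q * s, - Q:] [:- c, 1:] (insert k (A - {k})) =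
      (\<Prod>a\<in>insert k (A - {k}). x a) * (\<Prod>i<Suc (card (A - {k})). 1 - t ^ i * Q)"
      using Suc.prems A k by (intro node) auto
    then show ?thesis using A Suc by (simp add: insert_absorb[OF k(1)])
  next
    case False
    obtain k where k: "k \<in> A" using Suc.hyps(2) by fastforce
    define B where "B = A - {k}"
    have B: "k \<notin> B" "finite B" "A = insert k B" "n = card B" "inj_on x B" "x k \<notin> x ` B"
      using k Suc by (auto simp: B_def inj_on_def)
    let ?P = "cleared_poly t x [:Q * s, - Q:] [:- c, 1:] B"
    define R where "R = smult ((\<Prod>a\<in>B. x a) * (\<Prod>i<Suc n. 1 - t ^ i * Q))
      ([:0, 1:] * (\<Prod>a\<in>B. [:- x a, 1:]))"
    have sc: "s \<noteq> c"
    proof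
      assume "s = c"
      then have "t ^ n * Q = 1" using c \<open>s \<noteq> 0\<close> by (simp add: mult_ac)
      then show False using Q by blast
    qed
    have out: "s \<notin> x ` B" "c \<notin> x ` B" using False B by auto
    have eq: "?P = R"
    proof (rule poly_eqI_degree)
      fix z assume z: "z \<in> insert s (insert c (x ` B))"
      show "poly ?P z = poly R z"
      proof (cases "z \<in> x ` B")
        case True
        then obtain a where a: "a \<in> B" "z = x a" by auto
        then have "poly R z = 0" using B by (auto simp: R_def poly_prod)
        then show ?thesis using poly_cleared_poly_node[OF B(2,5) a(1)] a by simp
      next
        case False
        define y where "y = x(k := z)"
        have yB: "y a = x a" if "a \<in> B" for a using that B by (auto simp: y_def)
        have "y ` B = x ` B" "inj_on y B" using yB B by (auto simp: inj_on_def)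
        then have y: "inj_on y (insert k B)" "y k = s \<or> y k = c" "y k \<notin> y ` B" "y k = z"
          using False z B by (auto simp: y_def)
        have "?P = cleared_poly t y [:Q * s, - Q:] [:- c, 1:] B"
          using yB by (intro cleared_poly_cong) simp
        then have "poly ?P z = strip_sum t y [:Q * s, - Q:] [:- c, 1:] (insert k B) * (\<Prod>a\<in>B. y k - y a)"
          using strip_sum_insert_cleared[where x=y, OF B(2,1) y(3)] y(4) by simp
        also have "\<dots> = (\<Prod>a\<in>insert k B. y a) * (\<Prod>i<Suc (card B). 1 - t ^ i * Q) * (\<Prod>a\<in>B. y k - y a)"
          using node[OF B(1,2) y(1) B(4) y(2)] by simp
        also have "\<dots> = poly R z"
          using B y yB by (simp add: R_def poly_prod mult_ac)
        finally show ?thesis .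
      qed
    next
      have lin: "degree [:Q * s, - Q:] \<le> 1" "degree [:- c, 1:] \<le> 1" by simp_all
      have c: "card (insert s (insert c (x ` B))) = n + 2"
        using out sc B by (simp add: card_image)
      show "degree ?P < card (insert s (insert c (x ` B)))"
        using degree_cleared_poly[OF B(2) lin(1,2), of t x] c B by simp
      have "degree ([:0, 1:] * (\<Prod>a\<in>B. [:- x a, 1:])) \<le> 1 + card B"
        using degree_prod_linear_le[OF B(2), of "\<lambda>a. - x a" "\<lambda>_. 1"]
        by (intro order.trans[OF degree_mult_le] add_mono) auto
      then show "degree R < card (insert s (insert c (x ` B)))"
        unfolding R_def c using B by (intro le_less_trans[OF degree_smult_le]) simp
    qed
    have "strip_sum t x [:Q * s, - Q:] [:- c, 1:] A * (\<Prod>a\<in>B. x k - x a) =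
        ((\<Prod>a\<in>A. x a) * (\<Prod>i<card A. 1 - t ^ i * Q)) * (\<Prod>a\<in>B. x k - x a)"
      using strip_sum_insert_cleared[where x=x, OF B(2,1,6), of t "[:Q * s, - Q:]" "[:- c, 1:]"] B
      unfolding eq by (simp add: R_def poly_prod mult_ac)
    moreover have "(\<Prod>a\<in>B. x k - x a) \<noteq> 0" using B by auto
    ultimately show ?thesis by simp
  qed
qed

section \<open>Products over pairs of indices\<close>

definition index_pairs :: "nat \<Rightarrow> (nat \<times> nat) set" where
  "index_pairs N = {(i, j). 1 \<le> i \<and> i < j \<and> j \<le> N}"

lemma finite_index_pairs [simp]: "finite (index_pairs N)"
  by (rule finite_subset[of _ "{1..N} \<times> {1..N}"]) (auto simp: index_pairs_def)

lemma prod_index_pairs_snd: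
  fixes c :: "nat \<Rightarrow> 'a::comm_semiring_1"
  shows "(\<Prod>(i, j)\<in>index_pairs N. c j) = (\<Prod>j=1..N. c j ^ (j - 1))"
proof -
  have "(\<Prod>j=1..N. c j ^ (j - 1)) = (\<Prod>j=1..N. \<Prod>i\<in>{1..<j}. c j)" by simp
  also have "\<dots> = (\<Prod>(j, i)\<in>(SIGMA j:{1..N}. {1..<j}). c j)"
    by (rule prod.Sigma) auto
  also have "\<dots> = (\<Prod>(i, j)\<in>index_pairs N. c j)"
    by (rule prod.reindex_bij_witness[of _ prod.swap prod.swap]) (auto simp: index_pairs_def)
  finally show ?thesis by simp
qed

lemma prod_index_pairs_fst:
  fixes c :: "nat \<Rightarrow> 'a::comm_semiring_1"
  shows "(\<Prod>(i, j)\<in>index_pairs N. c i) = (\<Prod>i=1..N. c i ^ (N - i))"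
proof -
  have "(\<Prod>i=1..N. c i ^ (N - i)) = (\<Prod>i=1..N. \<Prod>j\<in>{i<..N}. c i)" by simp
  also have "\<dots> = (\<Prod>(i, j)\<in>(SIGMA i:{1..N}. {i<..N}). c i)"
    by (rule prod.Sigma) auto
  also have "(SIGMA i:{1..N}. {i<..N}) = index_pairs N"
    by (auto simp: index_pairs_def)
  finally show ?thesis by simp
qed

text \<open>
  Rewrites a product over the pairs separated by \<open>I\<close> as one over \<open>i < j\<close>, so that it can be compared
  factor by factor with the product over pairs in a summand.
\<close>

lemma prod_cut_index_pairs:
  fixes h :: "nat \<Rightarrow> nat \<Rightarrow> 'a::comm_monoid_mult"
  assumes "I \<subseteq> {1..N}"
  shows "(\<Prod>a\<in>I. \<Prod>b\<in>{1..N} - I. h a b) =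
    (\<Prod>(i, j)\<in>index_pairs N. if i \<in> I \<and> j \<notin> I then h i j else if i \<notin> I \<and> j \<in> I then h j i else 1)"
proof -
  let ?E = "{(i, j)\<in>index_pairs N. i \<in> I \<and> j \<notin> I}" and ?F = "{(i, j)\<in>index_pairs N. i \<notin> I \<and> j \<in> I}"
  have fin: "finite I" using assms finite_subset by blast
  have "I \<times> ({1..N} - I) = ?E \<union> prod.swap ` ?F"
  proof (rule set_eqI)
    fix ab show "ab \<in> I \<times> ({1..N} - I) \<longleftrightarrow> ab \<in> ?E \<union> prod.swap ` ?F"
    proof (cases ab)
      case (Pair a b)
      then show ?thesis using assms
        by (cases a b rule: linorder_cases) (auto simp: index_pairs_def image_iff)
    qed
  qed
  then have "(\<Prod>a\<in>I. \<Prod>b\<in>{1..N} - I. h a b) = (\<Prod>(a, b)\<in>?E \<union> prod.swap ` ?F. h a b)"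
    using fin by (simp add: prod.Sigma)
  also have "\<dots> = (\<Prod>(a, b)\<in>?E. h a b) * (\<Prod>(a, b)\<in>prod.swap ` ?F. h a b)"
  proof (rule prod.union_disjoint)
    show "finite ?E" "finite (prod.swap ` ?F)"
      by (auto intro!: finite_imageI intro: finite_subset[OF _ finite_index_pairs])
  qed (auto simp: index_pairs_def)
  also have "(\<Prod>(a, b)\<in>prod.swap ` ?F. h a b) = (\<Prod>(i, j)\<in>?F. h j i)"
    by (subst prod.reindex) (auto simp: case_prod_beta)
  also have "(\<Prod>(a, b)\<in>?E. h a b) =
      (\<Prod>(i, j)\<in>index_pairs N. if i \<in> I \<and> j \<notin> I then h i j else 1)"
    by (auto simp: prod.inter_filter case_prod_beta intro!: prod.mono_neutral_cong_left split: if_splits)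
  also have "(\<Prod>(i, j)\<in>?F. h j i) =
      (\<Prod>(i, j)\<in>index_pairs N. if i \<notin> I \<and> j \<in> I then h j i else 1)"
    by (auto simp: prod.inter_filter case_prod_beta intro!: prod.mono_neutral_cong_left split: if_splits)
  finally show ?thesis
    unfolding prod.distrib[symmetric] by (auto intro!: prod.cong split: if_splits simp: case_prod_beta)
qed

section \<open>The principal specialisation of the Kaneko--Macdonald binomial theorem\<close>

definition box_partitions :: "nat \<Rightarrow> nat \<Rightarrow> (nat \<Rightarrow> nat) set" where
  "box_partitions N M =
     {lam \<in> {1..N} \<rightarrow>\<^sub>E {0..M}. \<forall>i\<in>{1..N}. \<forall>j\<in>{1..N}. i \<le> j \<longrightarrow> lam j \<le> lam i}"

lemma finite_box_partitions [simp]: "finite (box_partitions N M)"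
  unfolding box_partitions_def by (rule finite_subset[OF Collect_subset]) (simp add: finite_PiE)

lemma box_partitionsD:
  assumes "lam \<in> box_partitions N M"
  shows "i \<in> {1..N} \<Longrightarrow> lam i \<le> M"
    and "1 \<le> i \<Longrightarrow> i \<le> j \<Longrightarrow> j \<le> N \<Longrightarrow> lam j \<le> lam i"
    and "i \<notin> {1..N} \<Longrightarrow> lam i = undefined"
  using assms by (auto simp: box_partitions_def PiE_iff extensional_def)

definition add_strip :: "nat \<Rightarrow> nat set \<Rightarrow> (nat \<Rightarrow> nat) \<Rightarrow> nat \<Rightarrow> nat" where
  "add_strip N I mu = (\<lambda>i\<in>{1..N}. mu i + of_bool (i \<in> I))"

definition remove_strip :: "nat \<Rightarrow> nat set \<Rightarrow> (nat \<Rightarrow> nat) \<Rightarrow> nat \<Rightarrow> nat" where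
  "remove_strip N I lam = (\<lambda>i\<in>{1..N}. lam i - of_bool (i \<in> I))"

lemma crossing:
  assumes "i < j" "\<not> P i" "P j"
  obtains k where "i \<le> k" "k < j" "\<not> P k" "P (Suc k)"
proof -
  have "\<exists>k. i \<le> k \<and> k < j \<and> \<not> P k \<and> P (Suc k)"
    using assms
  proof (induction j)
    case (Suc j)
    show ?case
    proof (cases "P j")
      case True
      then have "i < j" using Suc.prems by (metis less_antisym)
      then show ?thesis using Suc True by (meson less_SucI)
    next
      case False then show ?thesis using Suc.prems by (intro exI[of _ j]) auto
    qed
  qed simp
  then show thesis using that by blast
qed

text \<open>
  The weight detects strips that cannot be added or removed: neighbouring rows of equal length have
  points with ratio \<open>t\<close>.
\<close>

lemma strip_weight_eq_0:
  assumes "finite A" "I \<subseteq> A" "a \<in> I" "b \<in> A - I" "x a = t * x b"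
  shows "strip_weight t x A I = 0"
proof -
  have "(x a - t * x b) / (x a - x b) = 0" using assms(5) by simp
  then have "(\<Prod>b\<in>A - I. (x a - t * x b) / (x a - x b)) = 0"
    using assms(1,4) by (intro prod_zero) blast+
  then have "(\<Prod>a\<in>I. \<Prod>b\<in>A - I. (x a - t * x b) / (x a - x b)) = 0"
    using assms(3) finite_subset[OF assms(2,1)] by (intro prod_zero) blast+
  then show ?thesis by (simp add: strip_weight_def)
qed

text \<open>
  Independence of the monomials \<open>t\<^sup>a q\<^sup>b\<close> is all that is needed of \<open>q\<close> and \<open>t\<close>: it
  makes every denominator nonzero and the points of a partition distinct.
\<close>

locale generic_pair =
  fixes q t :: "'a::field"
  assumes indep: "t ^ a * q ^ b = t ^ c * q ^ d \<Longrightarrow> a = c \<and> b = d"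
begin

lemma t_nz [simp]: "t \<noteq> 0" using indep[of 1 0 2 0] by auto
lemma q_nz [simp]: "q \<noteq> 0" using indep[of 0 1 0 2] by auto

lemma one_minus_nz: "a \<noteq> 0 \<or> b \<noteq> 0 \<Longrightarrow> 1 - t ^ a * q ^ b \<noteq> 0"
  using indep[of a b 0 0] by auto

lemma qpoch_Suc: "qpoch a q (Suc l) = qpoch a q l * (1 - a * q ^ l)"
  by (simp add: qpoch_def)

lemma qpoch_nz: "qpoch (t ^ a * q) q l \<noteq> 0"
  using one_minus_nz[of a "Suc _"] by (auto simp: qpoch_def mult_ac)

text \<open>
  The products over pairs and rows together are, up to the power of \<open>w\<close>, the term of the partition
  in the q-binomial theorem at the special point.
\<close>

definition pair_factor :: "nat \<Rightarrow> nat \<Rightarrow> 'a" where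
  "pair_factor k d = ((1 - t ^ k * q ^ d) * qpoch (t ^ (k + 1)) q d) /
     ((1 - t ^ k) * qpoch (t ^ (k - 1) * q) q d)"

definition row_factor :: "nat \<Rightarrow> nat \<Rightarrow> nat \<Rightarrow> nat \<Rightarrow> 'a" where
  "row_factor N M i l =
     qpoch (t ^ (i - 1) * q) q M /
       (qpoch (t ^ (i - 1) * q) q (M - l) * qpoch (t ^ (N - i) * q) q l) *
     ((- 1) ^ l * t ^ ((i - 1) * l) * q ^ (l choose 2))"

definition summand :: "nat \<Rightarrow> nat \<Rightarrow> (nat \<Rightarrow> nat) \<Rightarrow> 'a" where
  "summand N M lam =
     (\<Prod>(i, j)\<in>index_pairs N. pair_factor (j - i) (lam i - lam j)) *
     (\<Prod>i=1..N. row_factor N M i (lam i))"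

text \<open>
  A common factor \<open>t\<^sup>N\<close> makes all exponents in the usual points \<open>q\<^bsup>\<lambda>(i)\<^esup> t\<^bsup>-i\<^esup>\<close> non-negative.
\<close>

definition point :: "nat \<Rightarrow> (nat \<Rightarrow> nat) \<Rightarrow> nat \<Rightarrow> 'a" where
  "point N lam i = t ^ (N - i) * q ^ lam i"

lemma point_nz [simp]: "point N lam i \<noteq> 0"
  by (simp add: point_def)

lemma inj_on_point: "inj_on (point N lam) {1..N}"
proof (rule inj_onI)
  fix i j assume "i \<in> {1..N}" "j \<in> {1..N}" "point N lam i = point N lam j"
  moreover from this have "N - i = N - j"
    using indep[of "N - i" "lam i" "N - j" "lam j"] by (simp add: point_def)
  ultimately show "i = j" by auto
qed

lemma pair_factor_Suc:
  assumes "1 \<le> k"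
  shows "pair_factor k (Suc d) * ((1 - t ^ k * q ^ d) * (1 - t ^ (k - 1) * q ^ Suc d)) =
    pair_factor k d * ((1 - t ^ k * q ^ Suc d) * (1 - t ^ Suc k * q ^ d))"
proof -
  define u v P R where "u = 1 - t ^ k * q ^ d" and "v = 1 - t ^ k * q ^ Suc d"
    and "P = qpoch (t ^ (k + 1)) q" and "R = qpoch (t ^ (k - 1) * q) q"
  have nz: "1 - t ^ k \<noteq> 0" "1 - t ^ (k - 1) * q ^ Suc d \<noteq> 0" "R d \<noteq> 0"
    using one_minus_nz[of k 0] one_minus_nz[of "k - 1" "Suc d"] assms qpoch_nz[of "k - 1" d]
    by (simp_all add: R_def)
  have "P (Suc d) = P d * (1 - t ^ Suc k * q ^ d)" "R (Suc d) = R d * (1 - t ^ (k - 1) * q ^ Suc d)"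
    by (simp_all add: P_def R_def qpoch_Suc mult.assoc)
  then show ?thesis
    unfolding pair_factor_def u_def[symmetric] v_def[symmetric] P_def[symmetric] R_def[symmetric]
    using nz by (simp del: power_Suc)
qed

lemma row_factor_keep:
  assumes "l \<le> M" "i \<in> {1..N}"
  shows "row_factor N M i l * ((1 - t ^ (i - 1) * q ^ Suc M) * (t ^ (N - i) * q ^ l)) =
    row_factor N (Suc M) i l * (t ^ (N - i) * q ^ l - t ^ (N - 1) * q ^ Suc M)"
proof -
  define P where "P = qpoch (t ^ (i - 1) * q) q"
  have P: "P (Suc j) = P j * (1 - t ^ (i - 1) * q * q ^ j)" for j by (simp add: P_def qpoch_Suc)
  have nz: "P j \<noteq> 0" "qpoch (t ^ (N - i) * q) q j \<noteq> 0" for j by (simp_all add: P_def qpoch_nz)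
  have nz': "1 - t ^ (i - 1) * q * q ^ (M - l) \<noteq> 0"
    using one_minus_nz[of "i - 1" "Suc (M - l)"] by (simp add: mult_ac)
  have S: "Suc M - l = Suc (M - l)" using assms by simp
  have "N - 1 = (N - i) + (i - 1)" using assms by auto
  then have tN: "t ^ (N - 1) = t ^ (N - i) * t ^ (i - 1)" by (simp only: power_add)
  have qM: "q ^ M = q ^ (M - l) * q ^ l" using assms by (simp flip: power_add)
  have e: "t ^ (N - i) * q ^ l - t ^ (N - 1) * q ^ Suc M =
    t ^ (N - i) * q ^ l * (1 - t ^ (i - 1) * q * q ^ (M - l))"
    unfolding tN power_Suc qM by (simp add: algebra_simps)
  show ?thesis
    unfolding row_factor_def P_def[symmetric] e S P
    using nz nz' by (simp add: divide_simps)
qed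

lemma row_factor_step:
  assumes "l \<le> M" "i \<in> {1..N}"
  shows "row_factor N M i l * (- (q ^ M) * (1 - t ^ (i - 1) * q ^ Suc M) * (t ^ (N - i) * q ^ Suc l) *
      t ^ (i - 1)) =
    row_factor N (Suc M) i (Suc l) * (q ^ Suc M * (1 - t ^ (N - i) * q ^ Suc l) * t ^ (N - i))"
proof -
  define P where "P = qpoch (t ^ (i - 1) * q) q"
  define R where "R = qpoch (t ^ (N - i) * q) q"
  have P: "P (Suc j) = P j * (1 - t ^ (i - 1) * q * q ^ j)" for j by (simp add: P_def qpoch_Suc)
  have R: "R (Suc j) = R j * (1 - t ^ (N - i) * q * q ^ j)" for j by (simp add: R_def qpoch_Suc)
  have nz: "P j \<noteq> 0" "R j \<noteq> 0" for j by (simp_all add: P_def R_def qpoch_nz)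
  have nz': "1 - t ^ (N - i) * q * q ^ l \<noteq> 0"
    using one_minus_nz[of "N - i" "Suc l"] by (simp add: mult_ac)
  have S: "Suc M - Suc l = M - l" by simp
  show ?thesis
    unfolding row_factor_def P_def[symmetric] R_def[symmetric] S P R
    using nz nz' by (simp add: divide_simps choose_two_Suc power_add) (simp add: mult_ac)
qed

text \<open>
  Adding a strip changes a pair factor only if exactly one of the two rows grows. The power of \<open>t\<close>
  lost or gained in that case is \<open>c\<^sub>j / c\<^sub>i\<close>; in this form the product over all pairs is easily taken.
\<close>

lemma pair_factor_strip:
  assumes mu: "mu \<in> box_partitions N M" and I: "I \<subseteq> {1..N}"
    and lam: "add_strip N I mu \<in> box_partitions N (Suc M)" and ij: "(i, j) \<in> index_pairs N"
  defines "x \<equiv> \<lambda>i. inverse (point N mu i)" and "y \<equiv> point N (add_strip N I mu)"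
    and "c \<equiv> \<lambda>i. if i \<in> I then t else 1"
  shows "pair_factor (j - i) (mu i - mu j) *
      (if i \<in> I \<and> j \<notin> I then (x i - t * x j) / (x i - x j)
       else if i \<notin> I \<and> j \<in> I then (x j - t * x i) / (x j - x i) else 1) * c i =
    pair_factor (j - i) (add_strip N I mu i - add_strip N I mu j) *
      (if i \<in> I \<and> j \<notin> I then (y i - t * y j) / (y i - y j)
       else if i \<notin> I \<and> j \<in> I then (y j - t * y i) / (y j - y i) else 1) * c j"
proof -
  have b: "i \<in> {1..N}" "j \<in> {1..N}" "i < j" using ij by (auto simp: index_pairs_def)
  have m: "mu j \<le> mu i" using box_partitionsD(2)[OF mu, of i j] b by auto
  have m': "mu j + of_bool (j \<in> I) \<le> mu i + of_bool (i \<in> I)"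
    using box_partitionsD(2)[OF lam, of i j] b by (auto simp: add_strip_def)
  define k where "k = j - i"
  define Tj Qj where "Tj = t ^ (N - j)" and "Qj = q ^ mu j"
  have k: "1 \<le> k" "N - i = k + (N - j)" using b by (auto simp: k_def)
  have nz: "Tj \<noteq> 0" "Qj \<noteq> 0" by (simp_all add: Tj_def Qj_def)
  have tk: "t ^ k = t * t ^ (k - 1)" using k by (metis power_eq_if not_one_le_zero)
  have frac: "pair_factor k d * ((1 - t ^ Suc k * q ^ d) / (1 - t ^ k * q ^ d)) =
      pair_factor k (Suc d) * ((1 - t ^ (k - 1) * q ^ Suc d) / (1 - t ^ k * q ^ Suc d))" for d
  proof -
    have nz: "1 - t ^ k * q ^ d \<noteq> 0" "1 - t ^ k * q ^ Suc d \<noteq> 0"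
      using one_minus_nz[of k d] one_minus_nz[of k "Suc d"] k by auto
    have "pair_factor k d * (1 - t ^ Suc k * q ^ d) * (1 - t ^ k * q ^ Suc d) =
        pair_factor k (Suc d) * (1 - t ^ (k - 1) * q ^ Suc d) * (1 - t ^ k * q ^ d)"
      using pair_factor_Suc[OF k(1), of d] by (simp only: mult_ac)
    then show ?thesis using nz by (simp only: times_divide_eq_right frac_eq_eq if_False simp_thms)
  qed
  consider "i \<in> I \<longleftrightarrow> j \<in> I" | "i \<in> I" "j \<notin> I" | "i \<notin> I" "j \<in> I" by blast
  then show ?thesis
  proof cases
    case 1
    then show ?thesis using b by (auto simp: add_strip_def c_def)
  next
    case 2
    define d where "d = mu i - mu j"
    have d: "mu i = d + mu j" using m by (simp add: d_def)
    have Ni: "t ^ (N - i) = t ^ k * Tj" unfolding k(2) power_add Tj_def ..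
    have p: "point N mu i = Tj * Qj * (t ^ k * q ^ d)" "point N mu j = Tj * Qj"
      "y i = Tj * Qj * (t ^ k * q ^ Suc d)" "y j = Tj * Qj"
      using 2 b by (simp_all add: point_def y_def add_strip_def Ni d power_add Qj_def mult_ac flip: Tj_def)
    have e1: "(x i - t * x j) / (x i - x j) = (1 - t ^ Suc k * q ^ d) / (1 - t ^ k * q ^ d)"
    proof -
      define s where "s = t ^ k * q ^ d"
      have s: "s \<noteq> 0" "1 - s \<noteq> 0" "t ^ k * q ^ d = s" "t ^ Suc k * q ^ d = t * s"
        using one_minus_nz[of k d] k by (simp_all add: s_def)
      have xx: "x i = 1 / (Tj * Qj * s)" "x j = 1 / (Tj * Qj)"
        unfolding x_def p s by (simp_all add: divide_inverse)
      have "x i - t * x j = (1 - t * s) / (Tj * Qj * s)" "x i - x j = (1 - s) / (Tj * Qj * s)"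
        unfolding xx using nz s(1) by (simp_all add: divide_simps)
      then show ?thesis using nz s by simp
    qed
    have e2: "(y i - t * y j) / (y i - y j) = t * (1 - t ^ (k - 1) * q ^ Suc d) / (1 - t ^ k * q ^ Suc d)"
    proof -
      have "y i - y j = - (Tj * Qj * (1 - t ^ k * q ^ Suc d))" unfolding p by (simp add: algebra_simps)
      moreover have "y i - t * y j = - (Tj * Qj * (t * (1 - t ^ (k - 1) * q ^ Suc d)))"
        unfolding p tk by (simp add: algebra_simps)
      ultimately show ?thesis using nz by simp
    qed
    have "pair_factor k d * ((1 - t ^ Suc k * q ^ d) / (1 - t ^ k * q ^ d)) * t =
        pair_factor k (Suc d) * (t * (1 - t ^ (k - 1) * q ^ Suc d) / (1 - t ^ k * q ^ Suc d))"
      using frac by (simp add: mult_ac)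
    moreover have "add_strip N I mu i - add_strip N I mu j = Suc d" "mu i - mu j = d"
      using 2 b by (simp_all add: add_strip_def d)
    ultimately show ?thesis
      using 2 by (simp only: e1 e2 k_def[symmetric] c_def if_True if_False simp_thms mult_1_right)
  next
    case 3
    define d where "d = mu i - Suc (mu j)"
    have d: "mu i = d + Suc (mu j)" using m' 3 by (simp add: d_def)
    have Ni: "t ^ (N - i) = t ^ k * Tj" unfolding k(2) power_add Tj_def ..
    have p: "point N mu i = Tj * Qj * (t ^ k * q ^ Suc d)" "point N mu j = Tj * Qj"
      "y i = Tj * Qj * q * (t ^ k * q ^ d)" "y j = Tj * Qj * q"
      using 3 b by (simp_all add: point_def y_def add_strip_def Ni d power_add Qj_def mult_ac flip: Tj_def)
    have e1: "(x j - t * x i) / (x j - x i) =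
      t * (1 - t ^ (k - 1) * q ^ Suc d) / (1 - t ^ k * q ^ Suc d)"
    proof -
      define s where "s = t ^ k * q ^ Suc d"
      have s: "s \<noteq> 0" "1 - s \<noteq> 0" "t ^ k * q ^ Suc d = s" "t * (1 - t ^ (k - 1) * q ^ Suc d) = t - s"
        using one_minus_nz[of k "Suc d"] by (simp_all add: s_def tk algebra_simps)
      have xx: "x i = 1 / (Tj * Qj * s)" "x j = 1 / (Tj * Qj)"
        unfolding x_def p s by (simp_all add: divide_inverse)
      have "x j - t * x i = - (t - s) / (Tj * Qj * s)" "x j - x i = - (1 - s) / (Tj * Qj * s)"
        unfolding xx using nz s(1) by (simp_all add: divide_simps)
      moreover have "- (t - s) / - (1 - s) = (t - s) / (1 - s)" by (rule minus_divide_divide)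
      ultimately show ?thesis using nz s by simp
    qed
    have e2: "(y j - t * y i) / (y j - y i) = (1 - t ^ Suc k * q ^ d) / (1 - t ^ k * q ^ d)"
    proof -
      have "y j - y i = Tj * Qj * q * (1 - t ^ k * q ^ d)" unfolding p by (simp add: algebra_simps)
      moreover have "y j - t * y i = Tj * Qj * q * (1 - t ^ Suc k * q ^ d)"
        unfolding p by (simp add: algebra_simps)
      ultimately show ?thesis using nz by simp
    qed
    have "pair_factor k (Suc d) * (t * (1 - t ^ (k - 1) * q ^ Suc d) / (1 - t ^ k * q ^ Suc d)) =
        pair_factor k d * ((1 - t ^ Suc k * q ^ d) / (1 - t ^ k * q ^ d)) * t"
      using frac by (simp add: mult_ac)
    moreover have "add_strip N I mu i - add_strip N I mu j = d" "mu i - mu j = Suc d"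
      using 3 b by (simp_all add: add_strip_def d)
    ultimately show ?thesis
      using 3 by (simp only: e1 e2 k_def[symmetric] c_def if_True if_False simp_thms mult_1_right)
  qed
qed


text \<open>
  The transition from \<open>\<mu>\<close> to \<open>\<mu> + 1\<^sub>I\<close> turns the Pieri coefficient at \<open>\<mu>\<close>, which is a weight at
  the inverse points, into a weight at the points of \<open>\<mu> + 1\<^sub>I\<close>, and the row factors supply linear factors
  as in \<open>strip_sum_linear\<close> with \<open>s = 1\<close>, \<open>Q = q\<^sup>M\<^sup>+\<^sup>1\<close> and \<open>c = t\<^sup>N\<^sup>-\<^sup>1 Q\<close>.
\<close>

lemma summand_strip:
  assumes mu: "mu \<in> box_partitions N M" and I: "I \<subseteq> {1..N}"
    and lam: "add_strip N I mu \<in> box_partitions N (Suc M)"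
  defines "y \<equiv> point N (add_strip N I mu)"
  shows "summand N M mu * strip_weight t (\<lambda>i. inverse (point N mu i)) {1..N} I * (- (q ^ M)) ^ card I *
      ((\<Prod>i\<in>{1..N}. y i) * (\<Prod>i<N. 1 - t ^ i * q ^ Suc M)) =
    summand N (Suc M) (add_strip N I mu) *
      (strip_weight t y {1..N} I * (\<Prod>i\<in>I. poly [:q ^ Suc M, - (q ^ Suc M):] (y i)) *
       (\<Prod>i\<in>{1..N} - I. poly [:- (t ^ (N - 1) * q ^ Suc M), 1:] (y i)))"
proof -
  define x where "x = (\<lambda>i. inverse (point N mu i))"
  define c where "c = (\<lambda>i::nat. if i \<in> I then t else 1)"
  define lm where "lm = add_strip N I mu"
  define Q where "Q = q ^ Suc M"
  define e where "e = (\<lambda>i. if i \<in> I then - (q ^ M) else 1)"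
  define w where "w = (\<lambda>i. if i \<in> I then Q * (1 - y i) else y i - t ^ (N - 1) * Q)"
  have fin: "finite I" using I finite_subset by blast
  have split: "(\<Prod>i\<in>{1..N}. if i \<in> I then f i else g i) = (\<Prod>i\<in>I. f i) * (\<Prod>i\<in>{1..N} - I. g i)"
    for f g :: "nat \<Rightarrow> 'a"
  proof -
    have "{1..N} = I \<union> ({1..N} - I)" using I by auto
    then have "(\<Prod>i\<in>{1..N}. if i \<in> I then f i else g i) =
      (\<Prod>i\<in>I \<union> ({1..N} - I). if i \<in> I then f i else g i)" by simp
    also have "\<dots> = (\<Prod>i\<in>I. if i \<in> I then f i else g i) * (\<Prod>i\<in>{1..N} - I. if i \<in> I then f i else g i)"
      using fin by (intro prod.union_disjoint) auto
    finally show ?thesis by simp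
  qed
  have pairs: "(\<Prod>(i, j)\<in>index_pairs N. pair_factor (j - i) (mu i - mu j)) *
      (\<Prod>a\<in>I. \<Prod>b\<in>{1..N} - I. (x a - t * x b) / (x a - x b)) * (\<Prod>i=1..N. c i ^ (N - i)) =
    (\<Prod>(i, j)\<in>index_pairs N. pair_factor (j - i) (lm i - lm j)) *
      (\<Prod>a\<in>I. \<Prod>b\<in>{1..N} - I. (y a - t * y b) / (y a - y b)) * (\<Prod>i=1..N. c i ^ (i - 1))"
    unfolding prod_cut_index_pairs[OF I] prod_index_pairs_fst[symmetric] prod_index_pairs_snd[symmetric]
      prod.distrib[symmetric]
  proof (rule prod.cong, rule refl)
    fix ij assume ij: "ij \<in> index_pairs N"
    obtain i j where eq: "ij = (i, j)" by (cases ij)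
    show "(case ij of (i, j) \<Rightarrow> pair_factor (j - i) (mu i - mu j)) *
       (case ij of (i, j) \<Rightarrow> if i \<in> I \<and> j \<notin> I then (x i - t * x j) / (x i - x j)
         else if i \<notin> I \<and> j \<in> I then (x j - t * x i) / (x j - x i) else 1) *
       (case ij of (i, j) \<Rightarrow> c i) =
      (case ij of (i, j) \<Rightarrow> pair_factor (j - i) (lm i - lm j)) *
       (case ij of (i, j) \<Rightarrow> if i \<in> I \<and> j \<notin> I then (y i - t * y j) / (y i - y j)
         else if i \<notin> I \<and> j \<in> I then (y j - t * y i) / (y j - y i) else 1) *
       (case ij of (i, j) \<Rightarrow> c j)"
      using pair_factor_strip[OF mu I lam, of i j] ij
      unfolding eq by (simp only: prod.case x_def y_def c_def lm_def)
  qed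
  have rows: "(\<Prod>i=1..N. row_factor N M i (mu i)) * (\<Prod>i=1..N. e i) *
      ((\<Prod>i=1..N. y i) * (\<Prod>i=1..N. 1 - t ^ (i - 1) * Q)) * (\<Prod>i=1..N. c i ^ (i - 1)) =
    (\<Prod>i=1..N. row_factor N (Suc M) i (lm i)) * (\<Prod>i=1..N. w i) * (\<Prod>i=1..N. c i ^ (N - i))"
    unfolding prod.distrib[symmetric]
  proof (rule prod.cong, rule refl)
    fix i assume i: "i \<in> {1..N}"
    have l: "mu i \<le> M" using box_partitionsD(1)[OF mu i] .
    show "row_factor N M i (mu i) * e i * (y i * (1 - t ^ (i - 1) * Q)) * c i ^ (i - 1) =
      row_factor N (Suc M) i (lm i) * w i * c i ^ (N - i)"
    proof (cases "i \<in> I")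
      case True
      then have *: "lm i = Suc (mu i)" "y i = t ^ (N - i) * q ^ Suc (mu i)"
        using i by (simp_all add: lm_def y_def point_def add_strip_def)
      show ?thesis using True row_factor_step[OF l i]
        unfolding e_def c_def w_def * Q_def by (simp only: if_True mult_ac)
    next
      case False
      then have *: "lm i = mu i" "y i = t ^ (N - i) * q ^ mu i"
        using i by (simp_all add: lm_def y_def point_def add_strip_def)
      show ?thesis using False row_factor_keep[OF l i]
        unfolding e_def c_def w_def * Q_def by (simp only: if_False mult_ac power_one mult_1_right mult_1_left)
    qed
  qed
  have cnz: "(\<Prod>i=1..N. c i ^ k i) \<noteq> 0" for k by (auto simp: c_def)
  have e: "(\<Prod>i=1..N. e i) = (- (q ^ M)) ^ card I"
    unfolding e_def split by simp
  have w: "(\<Prod>i=1..N. w i) = (\<Prod>i\<in>I. poly [:Q, - Q:] (y i)) *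
       (\<Prod>i\<in>{1..N} - I. poly [:- (t ^ (N - 1) * Q), 1:] (y i))"
    unfolding w_def split by (simp add: algebra_simps)
  have r: "(\<Prod>i=1..N. 1 - t ^ (i - 1) * Q) = (\<Prod>i<N. 1 - t ^ i * Q)"
    by (rule prod.reindex_bij_witness[of _ Suc "\<lambda>i. i - 1"]) auto
  define C D where "C = (\<Prod>i=1..N. c i ^ (N - i))" and "D = (\<Prod>i=1..N. c i ^ (i - 1))"
  define X Y where "X = (\<Prod>a\<in>I. \<Prod>b\<in>{1..N} - I. (x a - t * x b) / (x a - x b))"
    and "Y = (\<Prod>a\<in>I. \<Prod>b\<in>{1..N} - I. (y a - t * y b) / (y a - y b))"
  define V V' R R' where
    "V = (\<Prod>(i, j)\<in>index_pairs N. pair_factor (j - i) (mu i - mu j))" and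
    "V' = (\<Prod>(i, j)\<in>index_pairs N. pair_factor (j - i) (lm i - lm j))" and
    "R = (\<Prod>i=1..N. row_factor N M i (mu i))" and
    "R' = (\<Prod>i=1..N. row_factor N (Suc M) i (lm i))"
  define E W Z T where "E = (\<Prod>i=1..N. e i)" and "W = (\<Prod>i=1..N. w i)" and
    "Z = (\<Prod>i=1..N. y i) * (\<Prod>i=1..N. 1 - t ^ (i - 1) * Q)" and "T = t ^ (card I choose 2)"
  have 1: "V * X * C = V' * Y * D"
    using pairs by (simp only: V_def V'_def X_def Y_def C_def D_def)
  have 2: "R * E * Z * D = R' * W * C"
    using rows by (simp only: R_def R'_def E_def Z_def W_def C_def D_def)
  have CD: "C * D \<noteq> 0"
    using cnz[of "\<lambda>i. N - i"] cnz[of "\<lambda>i. i - 1"] by (simp only: C_def D_def mult_eq_0_iff) simp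
  have "(V * R * (T * X) * E * Z) * (C * D) = (V * X * C) * (R * E * Z * D) * T"
    by (simp only: mult_ac)
  also have "\<dots> = (V' * R' * (T * Y * W)) * (C * D)"
    unfolding 1 2 by (simp only: mult_ac)
  finally have "V * R * (T * X) * E * Z = V' * R' * (T * Y * W)"
    using CD by (simp only: mult_cancel_right) simp
  then show ?thesis
    unfolding summand_def strip_weight_def V_def V'_def R_def R'_def E_def W_def Z_def T_def X_def Y_def
      e w r unfolding x_def lm_def y_def Q_def by (simp only: mult_ac)
qed

lemma strip_weight_inverse_point_eq_0:
  assumes mu: "mu \<in> box_partitions N M" and I: "I \<subseteq> {1..N}"
    and bad: "add_strip N I mu \<notin> box_partitions N (Suc M)"
  shows "strip_weight t (\<lambda>i. inverse (point N mu i)) {1..N} I = 0"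
proof -
  have "add_strip N I mu \<in> {1..N} \<rightarrow>\<^sub>E {0..Suc M}"
    using box_partitionsD(1)[OF mu] by (fastforce simp: add_strip_def)
  then obtain i j where ij: "i \<in> {1..N}" "j \<in> {1..N}" "i \<le> j"
      "mu j + of_bool (j \<in> I) > mu i + of_bool (i \<in> I)"
    using bad by (auto simp: box_partitions_def add_strip_def not_le)
  have m: "mu j \<le> mu i" using box_partitionsD(2)[OF mu, of i j] ij by auto
  then have "j \<in> I" "i \<notin> I" "mu i = mu j" "i < j"
    using ij by (auto simp: of_bool_def order.strict_iff_order split: if_splits)
  then obtain k where k: "i \<le> k" "k < j" "k \<notin> I" "Suc k \<in> I"
    using crossing[of i j "\<lambda>k. k \<in> I"] by blast
  have "mu (Suc k) \<le> mu k" "mu k \<le> mu i" "mu j \<le> mu (Suc k)"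
    using k ij by (auto intro!: box_partitionsD(2)[OF mu])
  then have "mu k = mu (Suc k)" using \<open>mu i = mu j\<close> by simp
  moreover have "N - k = Suc (N - Suc k)" using k ij by auto
  ultimately have "point N mu k = t * point N mu (Suc k)"
    by (simp add: point_def)
  then have "inverse (point N mu (Suc k)) = t * inverse (point N mu k)" by simp
  moreover have "k \<in> {1..N} - I" using k ij by auto
  ultimately show ?thesis
    using strip_weight_eq_0[OF finite_atLeastAtMost I k(4), where x="\<lambda>i. inverse (point N mu i)"] by blast
qed

lemma strip_weight_point_eq_0:
  assumes lam: "lam \<in> box_partitions N M" and I: "I \<subseteq> {1..N}"
    and ij: "i \<in> I" "j \<notin> I" "i < j" "j \<le> N" "lam i = lam j"
  shows "strip_weight t (point N lam) {1..N} I = 0"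
proof -
  obtain k where k: "i \<le> k" "k < j" "k \<in> I" "Suc k \<notin> I"
    using crossing[of i j "\<lambda>k. k \<notin> I"] ij by blast
  have "1 \<le> i" using ij I by auto
  then have "lam (Suc k) \<le> lam k" "lam k \<le> lam i" "lam j \<le> lam (Suc k)"
    using k ij(4) by (auto intro!: box_partitionsD(2)[OF lam])
  then have "lam k = lam (Suc k)" using ij by simp
  moreover have "N - k = Suc (N - Suc k)" using k ij by auto
  ultimately have "point N lam k = t * point N lam (Suc k)"
    by (simp add: point_def)
  moreover have "Suc k \<in> {1..N} - I" using k ij by auto
  ultimately show ?thesis
    using strip_weight_eq_0[OF finite_atLeastAtMost I k(3)] by blast
qed

text \<open>
  All sets \<open>I\<close> may be admitted when the contributions to \<open>\<lambda>\<close> are collected. If removing the strip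
  does not lead to a partition in the smaller box, the linear factor of the last row (\<open>f(1) = 0\<close>) or of the first row (\<open>g(c) = 0\<close>)
  vanishes, or else the strip separates two neighbouring rows of equal length.
\<close>

lemma strip_term_eq_0:
  assumes lam: "lam \<in> box_partitions N (Suc M)" and I: "I \<subseteq> {1..N}"
    and bad: "remove_strip N I lam \<notin> box_partitions N M \<or> (\<exists>i\<in>I. lam i = 0)"
  shows "strip_weight t (point N lam) {1..N} I *
      (\<Prod>i\<in>I. poly [:q ^ Suc M, - (q ^ Suc M):] (point N lam i)) *
       (\<Prod>i\<in>{1..N} - I. poly [:- (t ^ (N - 1) * q ^ Suc M), 1:] (point N lam i)) = 0"
proof -
  have fin: "finite I" using I finite_subset by blast
  note le = box_partitionsD(2)[OF lam]
  consider (zero) i where "i \<in> I" "lam i = 0" | (top) i where "i \<in> {1..N} - I" "lam i = Suc M"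
    | (flat) i j where "i \<in> I" "j \<notin> I" "i < j" "j \<le> N" "lam i = lam j"
  proof (cases "(\<exists>i\<in>I. lam i = 0) \<or> (\<exists>i\<in>{1..N} - I. lam i = Suc M)")
    case True
    then show ?thesis using that by blast
  next
    case False
    then have "remove_strip N I lam i \<le> M" if "i \<in> {1..N}" for i
      using box_partitionsD(1)[OF lam that] that by (cases "i \<in> I") (force simp: remove_strip_def)+
    then have "remove_strip N I lam \<in> {1..N} \<rightarrow>\<^sub>E {0..M}"
      by (auto simp: remove_strip_def PiE_iff)
    then obtain i j where ij: "i \<in> {1..N}" "j \<in> {1..N}" "i \<le> j"
      "lam j - of_bool (j \<in> I) > lam i - of_bool (i \<in> I)"
      using bad False by (auto simp: box_partitions_def remove_strip_def not_le)
    have le_ij: "lam j \<le> lam i" using le[of i j] ij by auto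
    have I_ij: "j \<notin> I" "i \<in> I"
      using ij(4) le_ij by (cases "i \<in> I"; cases "j \<in> I"; simp)+
    have "lam i = lam j" using ij(4) le_ij I_ij by simp
    moreover have "i < j" using ij(3) I_ij by (cases "i = j") auto
    ultimately show ?thesis using that(3) ij(2) I_ij by auto
  qed
  then show ?thesis
  proof cases
    case zero
    have i: "1 \<le> i" "i \<le> N" using zero I by auto
    have lN: "lam N = 0" using le[of i N] zero i by simp
    show ?thesis
    proof (cases "N \<in> I")
      case True
      then show ?thesis using fin lN by (auto simp: point_def intro!: bexI[of _ N])
    next
      case False
      then have "i < N" using zero i by (metis order.not_eq_order_implies_strict)
      then show ?thesis using strip_weight_point_eq_0[OF lam I zero(1) False] lN zero by simp
    qed
  next
    case top
    have i: "1 \<le> i" "i \<le> N" using top I by auto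
    have l1: "lam 1 = Suc M" using le[of 1 i] box_partitionsD(1)[OF lam, of 1] top i by auto
    show ?thesis
    proof (cases "1 \<in> I")
      case False
      then have "1 \<in> {1..N} - I" using i by auto
      then show ?thesis using l1 by (auto simp: point_def intro!: bexI[of _ 1])
    next
      case True
      then have "1 < i" using top i by (metis DiffD2 order.not_eq_order_implies_strict)
      then show ?thesis using strip_weight_point_eq_0[OF lam I True, of i] l1 top i by simp
    qed
  next
    case flat
    then show ?thesis using strip_weight_point_eq_0[OF lam I flat] by simp
  qed
qed

text \<open>
  The induction step at a fixed \<open>\<lambda>\<close>. By \<open>summand_strip\<close> every term on the right is the summand of \<open>\<lambda>\<close>
  times a term of \<open>strip_sum_linear\<close>, and the value of that sum is the common denominator.
\<close>

theorem summand_recursion: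
  assumes lam: "lam \<in> box_partitions N (Suc M)"
  shows "summand N (Suc M) lam =
    (\<Sum>I | I \<subseteq> {1..N} \<and> (\<forall>i\<in>I. lam i \<noteq> 0) \<and> remove_strip N I lam \<in> box_partitions N M.
       summand N M (remove_strip N I lam) *
       strip_weight t (\<lambda>i. inverse (point N (remove_strip N I lam) i)) {1..N} I * (- (q ^ M)) ^ card I)"
    (is "_ = (\<Sum>I\<in>?S. ?f I)")
proof -
  let ?y = "point N lam"
  let ?K = "(\<Prod>i\<in>{1..N}. ?y i) * (\<Prod>i<N. 1 - t ^ i * q ^ Suc M)"
  let ?g = "\<lambda>I. strip_weight t ?y {1..N} I * (\<Prod>i\<in>I. poly [:q ^ Suc M, - (q ^ Suc M):] (?y i)) *
       (\<Prod>i\<in>{1..N} - I. poly [:- (t ^ (N - 1) * q ^ Suc M), 1:] (?y i))"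
  have nz: "1 - t ^ i * q ^ Suc M \<noteq> 0" for i using one_minus_nz[of i "Suc M"] by simp
  have K: "?K \<noteq> 0" using nz by simp
  have "(\<Sum>I\<in>?S. ?f I) * ?K = (\<Sum>I\<in>?S. summand N (Suc M) lam * ?g I)"
    unfolding sum_distrib_right
  proof (rule sum.cong, rule refl)
    fix I assume I: "I \<in> ?S"
    have "add_strip N I (remove_strip N I lam) = lam"
    proof
      fix i show "add_strip N I (remove_strip N I lam) i = lam i"
        using I box_partitionsD(3)[OF lam, of i]
        by (cases "i \<in> {1..N}") (auto simp: add_strip_def remove_strip_def)
    qed
    then show "?f I * ?K = summand N (Suc M) lam * ?g I"
      using summand_strip[of "remove_strip N I lam" N M I] I lam by (auto simp: mult_ac)
  qed
  also have "\<dots> = (\<Sum>I\<in>Pow {1..N}. summand N (Suc M) lam * ?g I)"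
  proof (rule sum.mono_neutral_left)
    show "\<forall>I\<in>Pow {1..N} - ?S. summand N (Suc M) lam * ?g I = 0"
    proof
      fix I assume "I \<in> Pow {1..N} - ?S"
      then have "?g I = 0" by (intro strip_term_eq_0[OF lam]) auto
      then show "summand N (Suc M) lam * ?g I = 0" by (simp only: mult_zero_right)
    qed
  qed auto
  also have "\<dots> = summand N (Suc M) lam *
      strip_sum t ?y [:q ^ Suc M * 1, - (q ^ Suc M):] [:- (t ^ (N - 1) * q ^ Suc M), 1:] {1..N}"
    by (simp only: strip_sum_def sum_distrib_left mult_1_right)
  also have "strip_sum t ?y [:q ^ Suc M * 1, - (q ^ Suc M):] [:- (t ^ (N - 1) * q ^ Suc M), 1:] {1..N} =
     (\<Prod>a\<in>{1..N}. ?y a) * (\<Prod>i<card {1..N}. 1 - t ^ i * q ^ Suc M)" if "N > 0"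
  proof (rule strip_sum_linear)
    show "t ^ (N - 1) * q ^ Suc M * t = 1 * q ^ Suc M * t ^ card {1..N}"
      using that by (cases N) auto
    show "t ^ i * q ^ Suc M \<noteq> 1" for i using nz[of i] by auto
  qed (simp_all only: inj_on_point t_nz finite_atLeastAtMost, simp_all)
  then have "summand N (Suc M) lam *
      strip_sum t ?y [:q ^ Suc M * 1, - (q ^ Suc M):] [:- (t ^ (N - 1) * q ^ Suc M), 1:] {1..N} =
    summand N (Suc M) lam * ?K"
    by (cases "N = 0") (auto simp: strip_sum_def strip_weight_def numeral_2_eq_2)
  finally show ?thesis using K by simp
qed

text \<open>
  Induction on the width \<open>M\<close> of the box: the new factor \<open>\<Prod>\<^sub>i (1 - t\<^sup>i q\<^sup>M w)\<close> is expanded by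
  \<open>strip_sum_const\<close> at each \<open>\<mu>\<close>, and the resulting pairs \<open>(\<mu>, I)\<close> are regrouped by \<open>\<lambda> = \<mu> + 1\<^sub>I\<close>.
\<close>

theorem kaneko_binomial:
  "(\<Sum>lam\<in>box_partitions N M. summand N M lam * w ^ (\<Sum>i=1..N. lam i)) =
    (\<Prod>i<N. qpoch (t ^ i * w) q M)"
proof (induction M)
  case 0
  have "box_partitions N 0 = {\<lambda>i\<in>{1..N}. 0}"
    by (auto simp: box_partitions_def PiE_iff extensional_def fun_eq_iff)
  moreover have "pair_factor (j - i) 0 = 1" if "(i, j) \<in> index_pairs N" for i j
    using that one_minus_nz[of "j - i" 0] by (auto simp: pair_factor_def qpoch_def index_pairs_def)
  ultimately show ?case
    by (auto simp: summand_def row_factor_def qpoch_def numeral_2_eq_2 index_pairs_def case_prod_beta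
        intro!: prod.neutral)
next
  case (Suc M)
  let ?W = "\<lambda>mu I. strip_weight t (\<lambda>i. inverse (point N mu i)) {1..N} I"
  let ?S = "\<lambda>lam. {I. I \<subseteq> {1..N} \<and> (\<forall>i\<in>I. lam i \<noteq> 0) \<and> remove_strip N I lam \<in> box_partitions N M}"
  let ?T = "\<lambda>mu. {I. I \<subseteq> {1..N} \<and> add_strip N I mu \<in> box_partitions N (Suc M)}"
  have finT: "finite (?T mu)" for mu by (rule finite_subset[of _ "Pow {1..N}"]) auto
  have finS: "finite (?S mu)" for mu by (rule finite_subset[of _ "Pow {1..N}"]) auto
  have strips: "(\<Prod>i<N. 1 - t ^ i * w * q ^ M) = (\<Sum>I\<in>?T mu. ?W mu I * (- (q ^ M)) ^ card I * w ^ card I)"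
    if mu: "mu \<in> box_partitions N M" for mu
  proof -
    have "(\<Prod>i<N. 1 - t ^ i * w * q ^ M) =
      strip_sum t (\<lambda>i. inverse (point N mu i)) [:- (w * q ^ M):] 1 {1..N}"
    proof -
      have "strip_sum t (\<lambda>i. inverse (point N mu i)) [:- (w * q ^ M):] 1 {1..N} =
          (\<Prod>i<card {1..N}. 1 - w * q ^ M * t ^ i)"
      proof (rule strip_sum_const)
        show "inj_on (\<lambda>i. inverse (point N mu i)) {1..N}"
          using inj_onD[OF inj_on_point[of N mu]] by (intro inj_onI) simp
      qed auto
      moreover have "t ^ i * w * q ^ M = w * q ^ M * t ^ i" for i by (simp only: mult_ac)
      ultimately show ?thesis by (simp only: card_atLeastAtMost diff_Suc_1)
    qed
    also have "\<dots> = (\<Sum>I\<in>Pow {1..N}. ?W mu I * (- (q ^ M)) ^ card I * w ^ card I)"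
    proof -
      have "- (w * q ^ M) = - (q ^ M) * w" by simp
      then have "(- (w * q ^ M)) ^ k = (- (q ^ M)) ^ k * w ^ k" for k
        by (simp only: power_mult_distrib)
      then show ?thesis by (simp add: strip_sum_def mult.assoc)
    qed
    also have "\<dots> = (\<Sum>I\<in>?T mu. ?W mu I * (- (q ^ M)) ^ card I * w ^ card I)"
      using strip_weight_inverse_point_eq_0[OF mu] by (intro sum.mono_neutral_right) auto
    finally show ?thesis .
  qed
  have size: "(\<Sum>i=1..N. add_strip N I mu i) = (\<Sum>i=1..N. mu i) + card I" if "I \<subseteq> {1..N}" for I mu
  proof -
    have "(\<Sum>i=1..N. add_strip N I mu i) = (\<Sum>i=1..N. mu i + of_bool (i \<in> I))"
      by (intro sum.cong) (auto simp: add_strip_def)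
    also have "\<dots> = (\<Sum>i=1..N. mu i) + card ({1..N} \<inter> I)"
      by (simp add: sum.distrib flip: Int_def)
    finally show ?thesis using that by (simp add: Int_absorb1)
  qed
  have "(\<Prod>i<N. qpoch (t ^ i * w) q (Suc M)) =
      (\<Prod>i<N. qpoch (t ^ i * w) q M) * (\<Prod>i<N. 1 - t ^ i * w * q ^ M)"
    by (simp add: qpoch_Suc prod.distrib)
  also have "\<dots> = (\<Sum>mu\<in>box_partitions N M. \<Sum>I\<in>?T mu.
      summand N M mu * ?W mu I * (- (q ^ M)) ^ card I * w ^ (\<Sum>i=1..N. add_strip N I mu i))"
    unfolding Suc.IH[symmetric] sum_distrib_right
  proof (rule sum.cong, rule refl)
    fix mu assume mu: "mu \<in> box_partitions N M"
    show "summand N M mu * w ^ (\<Sum>i=1..N. mu i) * (\<Prod>i<N. 1 - t ^ i * w * q ^ M) =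
        (\<Sum>I\<in>?T mu. summand N M mu * ?W mu I * (- (q ^ M)) ^ card I *
          w ^ (\<Sum>i=1..N. add_strip N I mu i))"
      unfolding strips[OF mu] sum_distrib_left
    proof (rule sum.cong, rule refl)
      fix I assume "I \<in> ?T mu"
      then show "summand N M mu * w ^ (\<Sum>i=1..N. mu i) * (?W mu I * (- (q ^ M)) ^ card I * w ^ card I) =
          summand N M mu * ?W mu I * (- (q ^ M)) ^ card I * w ^ (\<Sum>i=1..N. add_strip N I mu i)"
        using size[of I mu] by (simp only: mem_Collect_eq power_add mult_ac)
    qed
  qed
  also have "\<dots> = (\<Sum>(mu, I)\<in>Sigma (box_partitions N M) ?T.
      summand N M mu * ?W mu I * (- (q ^ M)) ^ card I * w ^ (\<Sum>i=1..N. add_strip N I mu i))"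
    using finT by (intro sum.Sigma) auto
  also have "\<dots> = (\<Sum>(lam, I)\<in>Sigma (box_partitions N (Suc M)) ?S.
      summand N M (remove_strip N I lam) * ?W (remove_strip N I lam) I * (- (q ^ M)) ^ card I *
        w ^ (\<Sum>i=1..N. lam i))"
  proof -
    have add_remove: "add_strip N I (remove_strip N I lam) = lam"
      if "lam \<in> box_partitions N (Suc M)" "\<forall>i\<in>I. lam i \<noteq> 0" for lam I
    proof
      fix i show "add_strip N I (remove_strip N I lam) i = lam i"
        using that box_partitionsD(3)[OF that(1), of i]
        by (cases "i \<in> {1..N}") (auto simp: add_strip_def remove_strip_def)
    qed
    have remove_add: "remove_strip N I (add_strip N I mu) = mu"
      if "mu \<in> box_partitions N M" for mu I
    proof
      fix i show "remove_strip N I (add_strip N I mu) i = mu i"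
        using that box_partitionsD(3)[OF that(1), of i]
        by (cases "i \<in> {1..N}") (auto simp: add_strip_def remove_strip_def)
    qed
    show ?thesis
      by (rule sum.reindex_bij_witness[of _ "\<lambda>(lam, I). (remove_strip N I lam, I)"
            "\<lambda>(mu, I). (add_strip N I mu, I)"])
         (auto simp: add_remove remove_add, auto simp: add_strip_def subset_iff)
  qed
  also have "\<dots> = (\<Sum>lam\<in>box_partitions N (Suc M). \<Sum>I\<in>?S lam.
      summand N M (remove_strip N I lam) * ?W (remove_strip N I lam) I * (- (q ^ M)) ^ card I *
        w ^ (\<Sum>i=1..N. lam i))"
    using finS by (intro sum.Sigma[symmetric]) auto
  also have "\<dots> = (\<Sum>lam\<in>box_partitions N (Suc M). summand N (Suc M) lam * w ^ (\<Sum>i=1..N. lam i))"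
    by (intro sum.cong refl) (simp add: summand_recursion sum_distrib_right)
  finally show ?case by simp
qed

end

section \<open>Laurent polynomials and the substitution of the cube of q\<close>

text \<open>
  Used for the passage to fractions and for \<open>q \<mapsto> q\<^sup>3\<close>, on coefficients and on polynomials over these.
\<close>

lemma map_poly_hom_mult:
  fixes f :: "'a::comm_semiring_0 \<Rightarrow> 'b::comm_semiring_0"
  assumes 0: "f 0 = 0" and add: "\<And>a b. f (a + b) = f a + f b" and mult: "\<And>a b. f (a * b) = f a * f b"
  shows "map_poly f (p * r) = map_poly f p * map_poly f r"
proof (rule poly_eqI)
  fix n
  have sum: "f (\<Sum>i\<in>S. g i) = (\<Sum>i\<in>S. f (g i))" for g and S :: "nat set"
    by (induction S rule: infinite_finite_induct) (simp_all add: 0 add)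
  show "coeff (map_poly f (p * r)) n = coeff (map_poly f p * map_poly f r) n"
    by (simp add: coeff_map_poly 0 coeff_mult sum mult)
qed

lemma map_poly_hom_prod:
  fixes f :: "'a::comm_semiring_1 \<Rightarrow> 'b::comm_semiring_1"
  assumes "f 0 = 0" "f 1 = 1" "\<And>a b. f (a + b) = f a + f b" "\<And>a b. f (a * b) = f a * f b"
  shows "map_poly f (\<Prod>i\<in>S. g i) = (\<Prod>i\<in>S. map_poly f (g i))"
  by (induction S rule: infinite_finite_induct)
     (simp_all add: map_poly_hom_mult assms map_poly_1')

lemma q_cubed_0 [simp]: "q_cubed 0 = 0"
  by (simp add: q_cubed_def)

lemma q_cubed_single: "q_cubed (Poly_Mapping.single i a) = Poly_Mapping.single (3 * i) a"
  by (cases "a = 0") (simp_all add: q_cubed_def)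

lemma q_cubed_1 [simp]: "q_cubed 1 = 1"
  using q_cubed_single[of 0 1] by simp

lemma q_cubed_add: "q_cubed (f + g) = q_cubed f + q_cubed g"
  by (rule poly_mapping_eqI) (simp add: lookup_add lookup_q_cubed)

lemma q_cubed_sum: "q_cubed (\<Sum>i\<in>S. g i) = (\<Sum>i\<in>S. q_cubed (g i))"
  by (induction S rule: infinite_finite_induct) (simp_all add: q_cubed_add)

lemma q_cubed_mult: "q_cubed (f * g) = q_cubed f * q_cubed g"
proof -
  have dec: "h = (\<Sum>k\<in>Poly_Mapping.keys h. Poly_Mapping.single k (Poly_Mapping.lookup h k))" for h :: laurent
    by (rule poly_mapping_eqI) (simp add: lookup_sum lookup_single when_def in_keys_iff)
  define a b where "a = Poly_Mapping.lookup f" and "b = Poly_Mapping.lookup g"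
  have "q_cubed ((\<Sum>i\<in>Poly_Mapping.keys f. Poly_Mapping.single i (a i)) *
      (\<Sum>j\<in>Poly_Mapping.keys g. Poly_Mapping.single j (b j))) =
    q_cubed (\<Sum>i\<in>Poly_Mapping.keys f. Poly_Mapping.single i (a i)) *
      q_cubed (\<Sum>j\<in>Poly_Mapping.keys g. Poly_Mapping.single j (b j))"
    by (simp add: sum_product q_cubed_sum mult_single q_cubed_single distrib_left)
  then show ?thesis by (simp add: a_def b_def flip: dec)
qed

definition q_cubed_poly :: "laurent poly \<Rightarrow> laurent poly" where
  "q_cubed_poly = map_poly q_cubed"

lemma q_cubed_poly_simps [simp]: "q_cubed_poly 0 = 0" "q_cubed_poly 1 = 1"
  by (simp_all add: q_cubed_poly_def map_poly_1')

lemma q_cubed_poly_add: "q_cubed_poly (f + g) = q_cubed_poly f + q_cubed_poly g"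
  by (rule poly_eqI) (simp add: q_cubed_poly_def coeff_map_poly q_cubed_add)

lemma q_cubed_poly_uminus: "q_cubed_poly (- f) = - q_cubed_poly f"
  using q_cubed_poly_add[of f "- f"] by (simp add: eq_neg_iff_add_eq_0 add.commute)

lemma q_cubed_poly_mult: "q_cubed_poly (f * g) = q_cubed_poly f * q_cubed_poly g"
  unfolding q_cubed_poly_def by (rule map_poly_hom_mult) (simp_all add: q_cubed_add q_cubed_mult)

lemma q_cubed_poly_power: "q_cubed_poly (f ^ k) = q_cubed_poly f ^ k"
  by (induction k) (simp_all add: q_cubed_poly_mult)

lemma q_cubed_poly_pX: "q_cubed_poly pX = pX"
  by (simp add: q_cubed_poly_def pX_def map_poly_pCons)

lemma q_cubed_poly_qX: "q_cubed_poly (qX i) = qX (3 * i)"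
  by (simp add: q_cubed_poly_def qX_def map_poly_pCons q_cubed_single)

lemma qX_0: "qX 0 = 1"
  by (simp add: qX_def one_pCons)

lemma qX_mult: "qX a * qX b = qX (a + b)"
  by (simp add: qX_def mult_single add.commute)

lemma qX_power: "qX a ^ k = qX (int k * a)"
  by (induction k) (simp_all add: qX_0 qX_mult algebra_simps)

lemma prod_qX: "(\<Prod>k\<in>S. qX (f k)) = qX (\<Sum>k\<in>S. f k)"
  by (induction S rule: infinite_finite_induct) (simp_all add: qX_0 qX_mult)

lemma pX_power_qX: "pX ^ a * qX b = monom (Poly_Mapping.single b 1) a"
proof -
  have "pX ^ a = monom 1 a" by (simp add: pX_def monom_altdef)
  then show ?thesis by (simp add: qX_def mult.commute smult_monom)
qed

lemma to_fract_power: "to_fract (x ^ k) = to_fract x ^ k"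
  by (induction k) simp_all

lemma single_one_nz: "Poly_Mapping.single i (1::int) \<noteq> 0"
  by (metis lookup_single_eq lookup_zero zero_neq_one)

lemma q_var_nz: "q_var \<noteq> 0" and p_var_nz: "p_var \<noteq> 0"
proof -
  show "p_var \<noteq> 0" by (simp add: p_var_def pX_def)
  show "q_var \<noteq> 0" by (simp add: q_var_def qX_def single_one_nz)
qed

lemma to_fract_qX: "to_fract (qX i) = q_var powi i"
proof (cases "i \<ge> 0")
  case True
  have "qX i = qX 1 ^ nat i" using True by (simp add: qX_power)
  then show ?thesis using True by (simp add: to_fract_power q_var_def power_int_def)
next
  case False
  have "qX i * qX 1 ^ nat (- i) = 1" using False by (simp add: qX_power qX_mult qX_0)
  then have "to_fract (qX i) * q_var ^ nat (- i) = 1"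
    unfolding q_var_def to_fract_power[symmetric] to_fract_mult[symmetric] by simp
  then show ?thesis using False q_var_nz by (simp add: power_int_def field_simps)
qed

interpretation pq: generic_pair q_var p_var
proof
  fix a b c d assume "p_var ^ a * q_var ^ b = p_var ^ c * q_var ^ d"
  then have "to_fract (pX ^ a * qX 1 ^ b) = to_fract (pX ^ c * qX 1 ^ d)"
    by (simp add: p_var_def q_var_def to_fract_power)
  then have eq: "monom (Poly_Mapping.single (int b) (1::int)) a = monom (Poly_Mapping.single (int d) 1) c"
    by (simp add: qX_power pX_power_qX)
  have ac: "a = c" using arg_cong[OF eq, of degree] single_one_nz by (simp add: degree_monom_eq)
  have "Poly_Mapping.single (int b) (1::int) = Poly_Mapping.single (int d) 1"
    using arg_cong[OF eq, of "\<lambda>f. coeff f a"] ac by simp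
  then have "Poly_Mapping.lookup (Poly_Mapping.single (int b) (1::int)) (int d) =
      Poly_Mapping.lookup (Poly_Mapping.single (int d) 1) (int d)" by (simp only:)
  then have "b = d" by (simp add: lookup_single when_def split: if_splits)
  with ac show "a = c \<and> b = d" by simp
qed

section \<open>The product as a polynomial in an auxiliary variable\<close>

text \<open>
  The product \<open>\<Prod>\<^sub>i (p\<^sup>i w; q)\<^sub>2\<^sub>n\<close> at \<open>w = y / p\<^sup>m\<close>, cleared of denominators, as a polynomial in \<open>y\<close>.
  Negative powers of \<open>p\<close> are avoided because its coefficients have to be polynomials in \<open>p\<close>
  over the Laurent polynomials in \<open>q\<close>, where \<open>q \<mapsto> q\<^sup>3\<close> and the residue parts make sense.
\<close>

definition product_poly :: "nat \<Rightarrow> nat \<Rightarrow> laurent poly poly" where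
  "product_poly m n = (\<Prod>i<2*m+1. \<Prod>k<2*n. [:pX ^ m, - (pX ^ i * qX (int k)):])"

lemma degree_product_poly: "degree (product_poly m n) \<le> 2 * n * (2 * m + 1)"
proof -
  have "degree (product_poly m n) \<le> (\<Sum>i<2*m+1. degree (\<Prod>k<2*n. [:pX ^ m, - (pX ^ i * qX (int k)):]))"
    unfolding product_poly_def using degree_prod_sum_le[of "{..<2*m+1}"] by (simp add: o_def)
  also have "\<dots> \<le> (\<Sum>i<2*m+1. 2 * n)"
    using degree_prod_linear_le[of "{..<2*n}"] by (intro sum_mono) (simp add: le_trans)
  finally show ?thesis by (simp add: mult_ac)
qed

lemma box_size_le:
  assumes "lam \<in> box_partitions N M"
  shows "(\<Sum>i=1..N. lam i) \<le> M * N"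
proof -
  have "(\<Sum>i=1..N. lam i) \<le> (\<Sum>i=1..N. M)"
    using box_partitionsD(1)[OF assms] by (intro sum_mono) auto
  then show ?thesis by (simp add: mult.commute)
qed

text \<open>
  Both sides agree by \<open>kaneko_binomial\<close> for each value of \<open>y\<close>, so they agree as polynomials. Powers of \<open>q\<close>
  serve as sufficiently many values.
\<close>

lemma fract_poly_product_poly:
  "map_poly to_fract (product_poly m n) = (\<Sum>lam\<in>box_partitions (2*m+1) (2*n).
     monom (pq.summand (2*m+1) (2*n) lam * p_var ^ (m * (2 * n * (2*m+1) - (\<Sum>i=1..2*m+1. lam i))))
       (\<Sum>i=1..2*m+1. lam i))"
    (is "?L = ?R")
proof (rule poly_eqI_degree)
  let ?N = "2*m+1" and ?D = "2 * n * (2*m+1)"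
  let ?A = "(\<lambda>i. q_var ^ i) ` {..?D}"
  have "inj_on (\<lambda>i. q_var ^ i) {..?D}"
    using pq.indep[of 0 _ 0] by (auto intro!: inj_onI)
  then have A: "card ?A = Suc ?D" by (simp add: card_image)
  have "degree ?L \<le> degree (product_poly m n)" by (rule map_poly_degree_leq)
  then show "degree ?L < card ?A" using degree_product_poly[of m n] A by simp
  have "degree ?R \<le> ?D"
    by (intro degree_sum_le finite_box_partitions order.trans[OF degree_monom_le] box_size_le)
  then show "degree ?R < card ?A" using A by simp
  fix y
  define w where "w = y / p_var ^ m"
  have y: "y = p_var ^ m * w" by (simp add: w_def p_var_nz)
  have "?L = (\<Prod>i<?N. \<Prod>k<2*n. [:p_var ^ m, - (p_var ^ i * q_var ^ k):])"
    by (simp add: product_poly_def map_poly_hom_prod map_poly_pCons p_var_def q_var_def to_fract_qX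
        to_fract_power flip: q_var_def)
  then have "poly ?L y = (\<Prod>i<?N. \<Prod>k<2*n. p_var ^ m * (1 - p_var ^ i * w * q_var ^ k))"
    by (simp add: poly_prod y algebra_simps)
  also have "\<dots> = p_var ^ (m * ?D) * (\<Prod>i<?N. qpoch (p_var ^ i * w) q_var (2*n))"
  proof -
    have "p_var ^ (m * (a * b)) = ((p_var ^ m) ^ a) ^ b" for a b
      by (simp only: power_mult[symmetric] mult.assoc)
    moreover have "(\<Prod>i<?N. \<Prod>k<2*n. p_var ^ m * (1 - p_var ^ i * w * q_var ^ k)) =
        ((p_var ^ m) ^ (2 * n)) ^ ?N * (\<Prod>i<?N. qpoch (p_var ^ i * w) q_var (2*n))"
      unfolding qpoch_def prod.distrib prod_constant card_lessThan by (rule refl)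
    ultimately show ?thesis by (simp only:)
  qed
  also have "\<dots> = (\<Sum>lam\<in>box_partitions ?N (2*n). p_var ^ (m * ?D) *
      (pq.summand ?N (2*n) lam * w ^ (\<Sum>i=1..?N. lam i)))"
    by (simp add: pq.kaneko_binomial[symmetric] sum_distrib_left)
  also have "\<dots> = poly ?R y"
    unfolding poly_sum
  proof (rule sum.cong, rule refl)
    fix lam assume lam: "lam \<in> box_partitions ?N (2*n)"
    define s where "s = (\<Sum>i=1..?N. lam i)"
    define D where "D = ?D"
    have "D = (D - s) + s" using box_size_le[OF lam] by (simp add: s_def D_def)
    then have "m * D = m * (D - s) + m * s" by (simp flip: distrib_left)
    then have "p_var ^ (m * D) = p_var ^ (m * (D - s)) * (p_var ^ m) ^ s"
      by (simp only: power_add power_mult)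
    then have "p_var ^ (m * D) * (S * w ^ s) = poly (monom (S * p_var ^ (m * (D - s))) s) y" for S
      unfolding y poly_monom power_mult_distrib by (simp only: mult_ac)
    then show "p_var ^ (m * ?D) * (pq.summand ?N (2*n) lam * w ^ (\<Sum>i=1..?N. lam i)) =
      poly (monom (pq.summand ?N (2*n) lam * p_var ^ (m * (?D - (\<Sum>i=1..?N. lam i)))) (\<Sum>i=1..?N. lam i)) y"
      unfolding s_def D_def .
  qed
  finally show "poly ?L y = poly ?R y" .
qed

lemma to_fract_coeff_product_poly:
  "to_fract (coeff (product_poly m n) c) =
    (\<Sum>lam | lam \<in> box_partitions (2*m+1) (2*n) \<and> (\<Sum>i=1..2*m+1. lam i) = c.
      pq.summand (2*m+1) (2*n) lam * p_var ^ (m * (2 * n * (2*m+1) - c)))"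
proof -
  have "to_fract (coeff (product_poly m n) c) = coeff (map_poly to_fract (product_poly m n)) c"
    by (simp add: coeff_map_poly)
  also have "\<dots> = (\<Sum>lam\<in>box_partitions (2*m+1) (2*n). if (\<Sum>i=1..2*m+1. lam i) = c then
      pq.summand (2*m+1) (2*n) lam * p_var ^ (m * (2 * n * (2*m+1) - c)) else 0)"
    unfolding fract_poly_product_poly coeff_sum by (intro sum.cong) auto
  also have "\<dots> = (\<Sum>lam | lam \<in> box_partitions (2*m+1) (2*n) \<and> (\<Sum>i=1..2*m+1. lam i) = c.
      pq.summand (2*m+1) (2*n) lam * p_var ^ (m * (2 * n * (2*m+1) - c)))"
    by (rule sum.inter_filter[symmetric]) simp
  finally show ?thesis .
qed

lemma prod_centered:
  fixes G :: "nat \<Rightarrow> 'a::comm_monoid_mult"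
  shows "(\<Prod>i<2*m+1. G i) = G m * (\<Prod>j=1..m. G (m + j) * G (m - j))"
proof -
  have "{..<2*m+1} = insert m ((\<lambda>j. m + j) ` {1..m} \<union> (\<lambda>j. m - j) ` {1..m})"
  proof (rule set_eqI)
    fix i show "i \<in> {..<2*m+1} \<longleftrightarrow> i \<in> insert m ((\<lambda>j. m + j) ` {1..m} \<union> (\<lambda>j. m - j) ` {1..m})"
      by (cases i m rule: linorder_cases)
         (auto simp: image_iff intro: bexI[of _ "m - i"] bexI[of _ "i - m"])
  qed
  then have "(\<Prod>i<2*m+1. G i) =
      (\<Prod>i\<in>insert m ((\<lambda>j. m + j) ` {1..m} \<union> (\<lambda>j. m - j) ` {1..m}). G i)"
    by (rule arg_cong)
  also have "\<dots> = G m * (\<Prod>i\<in>(\<lambda>j. m + j) ` {1..m} \<union> (\<lambda>j. m - j) ` {1..m}. G i)"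
    by (subst prod.insert) auto
  also have "(\<Prod>i\<in>(\<lambda>j. m + j) ` {1..m} \<union> (\<lambda>j. m - j) ` {1..m}. G i) =
      (\<Prod>i\<in>(\<lambda>j. m + j) ` {1..m}. G i) * (\<Prod>i\<in>(\<lambda>j. m - j) ` {1..m}. G i)"
    by (rule prod.union_disjoint) auto
  also have "(\<Prod>i\<in>(\<lambda>j. m + j) ` {1..m}. G i) = (\<Prod>j=1..m. G (m + j))"
    by (subst prod.reindex) (auto simp: inj_on_def)
  also have "(\<Prod>i\<in>(\<lambda>j. m - j) ` {1..m}. G i) = (\<Prod>j=1..m. G (m - j))"
    by (subst prod.reindex) (auto simp: inj_on_def)
  finally show ?thesis by (simp only: prod.distrib)
qed

lemma qpoch_alt:
  "qpoch (pX ^ j * qX a) (qX b) n = (\<Prod>k<n. 1 - pX ^ j * qX (a + b * int k))"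
  by (simp only: qpoch_def qX_power qX_mult mult.assoc mult.commute[of b])

text \<open>
  The factors with \<open>k \<ge> n\<close> and \<open>k < n\<close> have \<open>q\<close>-exponents \<open>2 + 3k'\<close> and \<open>-1 - 3k'\<close> with \<open>k' < n\<close>. The index
  \<open>i = m + j\<close> gives two of the four products of \<open>F_prod\<close> for \<open>j\<close>; the index \<open>i = m - j\<close> gives the other two
  after each factor is divided by its second monomial. The index \<open>i = m\<close> gives the
  part of \<open>F_prod\<close> without \<open>p\<close>.
\<close>

lemma prod_gen_factors:
  "(\<Prod>i<2*m+1. \<Prod>k<2*n. pX ^ m - pX ^ i * qX (3 * int k + 2 - 3 * int n)) =
    (- 1) ^ n * pX ^ (n * m * (3 * m + 1)) *
      qX (int m * int n - int n - 3 * int (n choose 2)) * F_prod m n"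
proof -
  define G where "G = (\<lambda>i. (\<Prod>k<n. (pX ^ m - pX ^ i * qX (2 + 3 * int k)) *
     (pX ^ m - pX ^ i * qX (- 1 - 3 * int k))))"
  have G: "(\<Prod>k<2*n. pX ^ m - pX ^ i * qX (3 * int k + 2 - 3 * int n)) = G i" for i
  proof -
    let ?g = "\<lambda>k. pX ^ m - pX ^ i * qX (3 * int k + 2 - 3 * int n)"
    have "(\<Prod>k<2*n. ?g k) = (\<Prod>k\<in>{n..<2*n} \<union> {..<n}. ?g k)"
      by (rule prod.cong) auto
    also have "\<dots> = (\<Prod>k=n..<2*n. ?g k) * (\<Prod>k<n. ?g k)"
      by (rule prod.union_disjoint) auto
    also have "(\<Prod>k=n..<2*n. ?g k) = (\<Prod>k<n. pX ^ m - pX ^ i * qX (2 + 3 * int k))"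
      by (rule prod.reindex_bij_witness[of _ "\<lambda>k. k + n" "\<lambda>k. k - n"]) (auto simp: algebra_simps)
    also have "(\<Prod>k<n. ?g k) = (\<Prod>k<n. pX ^ m - pX ^ i * qX (- 1 - 3 * int k))"
      by (rule prod.reindex_bij_witness[of _ "\<lambda>k. n - 1 - k" "\<lambda>k. n - 1 - k"])
         (auto simp: of_nat_diff algebra_simps)
    finally show ?thesis by (simp add: G_def prod.distrib)
  qed
  have sq: "(pX ^ a) ^ n * (pX ^ a) ^ n = pX ^ (2 * a * n)" for a
    unfolding power_mult[symmetric] power_add[symmetric] by (rule arg_cong[where f="power pX"]) simp
  have up: "G (m + j) = pX ^ (2 * m * n) *
      (qpoch (pX ^ j * qX 2) (qX 3) n * qpoch (pX ^ j * qX (- 1)) (qX (- 3)) n)" for j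
  proof -
    have "G (m + j) = (\<Prod>k<n. (pX ^ m * pX ^ m) * ((1 - pX ^ j * qX (2 + 3 * int k)) *
        (1 - pX ^ j * qX (- 1 + - 3 * int k))))"
      unfolding G_def by (intro prod.cong) (simp_all add: power_add algebra_simps)
    then show ?thesis
      by (simp only: qpoch_alt prod.distrib prod_constant card_lessThan sq)
  qed
  have down: "G (m - j) = pX ^ (2 * (m - j) * n) * qX (int n) *
      (qpoch (pX ^ j * qX 1) (qX 3) n * qpoch (pX ^ j * qX (- 2)) (qX (- 3)) n)" if "j \<le> m" for j
  proof -
    have m: "pX ^ m = pX ^ (m - j) * pX ^ j" using that by (simp flip: power_add)
    have "(pX ^ m - pX ^ (m - j) * qX (2 + 3 * int k)) * (pX ^ m - pX ^ (m - j) * qX (- 1 - 3 * int k)) =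
        pX ^ (m - j) * pX ^ (m - j) * qX 1 *
          ((1 - pX ^ j * qX (1 + 3 * int k)) * (1 - pX ^ j * qX (- 2 + - 3 * int k)))" for k
    proof -
      define u v where "u = qX (2 + 3 * int k)" and "v = qX (1 + 3 * int k)"
      define u' v' where "u' = qX (- 2 + - 3 * int k)" and "v' = qX (- 1 - 3 * int k)"
      have uv: "u * u' = 1" "v' * v = 1" "u * v' = qX 1"
        by (simp_all add: u_def u'_def v_def v'_def qX_mult qX_0)
      have e: "u * (1 - c * u') = u - c" "v' * (1 - c * v) = v' - c" for c
      proof -
        have "u * (1 - c * u') = u - c * (u * u')" "v' * (1 - c * v) = v' - c * (v' * v)"
          by (simp_all only: right_diff_distrib mult_1_right mult.left_commute)
        then show "u * (1 - c * u') = u - c" "v' * (1 - c * v) = v' - c" by (simp_all add: uv)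
      qed
      have "(b * c - b * u) * (b * c - b * v') = b * b * qX 1 * ((1 - c * v) * (1 - c * u'))"
        for b c :: "laurent poly"
      proof -
        have "b * b * qX 1 * ((1 - c * v) * (1 - c * u')) =
            b * b * ((u * (1 - c * u')) * (v' * (1 - c * v)))"
          unfolding uv(3)[symmetric] by (simp only: mult_ac)
        also have "\<dots> = (b * c - b * u) * (b * c - b * v')"
          unfolding e by (simp add: algebra_simps)
        finally show ?thesis by simp
      qed
      then show ?thesis unfolding m u_def u'_def v_def v'_def .
    qed
    then have "G (m - j) = (\<Prod>k<n. pX ^ (m - j) * pX ^ (m - j) * qX 1 *
          ((1 - pX ^ j * qX (1 + 3 * int k)) * (1 - pX ^ j * qX (- 2 + - 3 * int k))))"
      unfolding G_def by (intro prod.cong) simp_all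
    then show ?thesis
      by (simp only: qpoch_alt prod.distrib prod_constant card_lessThan sq qX_power mult_1_right)
  qed
  have mid: "G m = (- 1) ^ n * pX ^ (2 * m * n) * qX (- int n - 3 * int (n choose 2)) *
      (qpoch (qX 1) (qX 3) n * qpoch (qX 2) (qX 3) n)"
  proof -
    have "(pX ^ m - pX ^ m * qX (2 + 3 * int k)) * (pX ^ m - pX ^ m * qX (- 1 - 3 * int k)) =
        (- 1) * (pX ^ m * pX ^ m) * qX (- 1 - 3 * int k) *
          ((1 - pX ^ 0 * qX (1 + 3 * int k)) * (1 - pX ^ 0 * qX (2 + 3 * int k)))" for k
    proof -
      define u v v' where "u = qX (2 + 3 * int k)" and "v = qX (1 + 3 * int k)" and "v' = qX (- 1 - 3 * int k)"
      have v: "v' * v = 1" by (simp add: v_def v'_def qX_mult qX_0)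
      have "(b - b * u) * (b - b * v') = (- 1) * (b * b) * v' * ((1 - v) * (1 - u))" for b
      proof -
        have "(- 1) * (b * b) * v' * ((1 - v) * (1 - u)) = b * b * ((v' * v - v') * (1 - u))"
          by (simp add: algebra_simps)
        also have "\<dots> = (b - b * u) * (b - b * v')" unfolding v by (simp add: algebra_simps)
        finally show ?thesis by simp
      qed
      then show ?thesis unfolding power_0 mult_1_left u_def v_def v'_def .
    qed
    then have "G m = (\<Prod>k<n. (- 1) * (pX ^ m * pX ^ m) * qX (- 1 - 3 * int k) *
          ((1 - pX ^ 0 * qX (1 + 3 * int k)) * (1 - pX ^ 0 * qX (2 + 3 * int k))))"
      unfolding G_def by (intro prod.cong) simp_all
    moreover have "(\<Sum>k<n. - 1 - 3 * int k) = - int n - 3 * int (n choose 2)"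
    proof (induction n)
      case 0
      show ?case by (simp add: numeral_2_eq_2)
    next
      case (Suc n)
      then show ?case by (simp add: choose_two_Suc)
    qed
    moreover have "qpoch (qX 1) (qX 3) n = qpoch (pX ^ 0 * qX 1) (qX 3) n"
      "qpoch (qX 2) (qX 3) n = qpoch (pX ^ 0 * qX 2) (qX 3) n" by simp_all
    ultimately show ?thesis
      by (simp only: qpoch_alt prod.distrib prod_qX prod_constant card_lessThan sq)
  qed
  have e: "2 * m * n + (\<Sum>j=1..m. 2 * m * n + 2 * (m - j) * n) = n * m * (3 * m + 1)"
  proof -
    define S where "S = (\<Sum>j=1..m. m - j)"
    have "S = (\<Sum>j<m. j)"
      unfolding S_def by (rule sum.reindex_bij_witness[of _ "\<lambda>j. m - j" "\<lambda>j. m - j"]) auto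
    moreover have "2 * (\<Sum>j<m. j) + m = m * m" by (induction m) simp_all
    ultimately have "n * (2 * S + m) = n * (m * m)" by simp
    moreover have "(\<Sum>j=1..m. 2 * m * n + 2 * (m - j) * n) = 2 * m * n * m + 2 * n * S"
      unfolding S_def sum.distrib sum_distrib_left by (simp add: mult_ac)
    ultimately show ?thesis by (simp add: algebra_simps)
  qed
  have "(\<Prod>j=1..m. G (m + j) * G (m - j)) = (\<Prod>j=1..m. (pX ^ (2 * m * n + 2 * (m - j) * n) * qX (int n)) *
     (qpoch (pX ^ j * qX 1) (qX 3) n * qpoch (pX ^ j * qX 2) (qX 3) n *
        (qpoch (pX ^ j * qX (-1)) (qX (-3)) n * qpoch (pX ^ j * qX (-2)) (qX (-3)) n)))"
    by (intro prod.cong refl) (simp add: up down power_add mult_ac)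
  also have "\<dots> = pX ^ (\<Sum>j=1..m. 2 * m * n + 2 * (m - j) * n) * qX (int m * int n) *
     (\<Prod>j=1..m. qpoch (pX ^ j * qX 1) (qX 3) n * qpoch (pX ^ j * qX 2) (qX 3) n *
        (qpoch (pX ^ j * qX (-1)) (qX (-3)) n * qpoch (pX ^ j * qX (-2)) (qX (-3)) n))"
    by (simp only: prod.distrib power_sum prod_qX) simp
  finally have "(\<Prod>i<2*m+1. G i) = (- 1) ^ n * pX ^ (n * m * (3 * m + 1)) *
     (qX (- int n - 3 * int (n choose 2)) * qX (int m * int n)) * F_prod m n"
    unfolding prod_centered mid F_prod_def e[symmetric] power_add by (simp only: mult_ac)
  moreover have "qX (- int n - 3 * int (n choose 2)) * qX (int m * int n) =
      qX (int m * int n - int n - 3 * int (n choose 2))"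
    by (simp add: qX_mult algebra_simps)
  ultimately show ?thesis by (simp only: G)
qed

section \<open>Extraction of residue classes of exponents\<close>

definition residue_poly :: "int \<Rightarrow> laurent poly \<Rightarrow> laurent poly" where
  "residue_poly r = map_poly (residue_part r)"

lemma residue_part_0 [simp]: "residue_part r 0 = 0"
  by (rule poly_mapping_eqI) (simp add: lookup_residue_part)

lemma residue_part_add: "residue_part r (f + g) = residue_part r f + residue_part r g"
  by (rule poly_mapping_eqI) (simp add: lookup_residue_part lookup_add)

lemma coeff_residue_poly: "coeff (residue_poly r f) k = residue_part r (coeff f k)"
  by (simp add: residue_poly_def coeff_map_poly)

lemma residue_poly_add: "residue_poly r (f + g) = residue_poly r f + residue_poly r g"
  by (rule poly_eqI) (simp add: coeff_residue_poly residue_part_add)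

lemma residue_poly_0 [simp]: "residue_poly r 0 = 0"
  by (simp add: residue_poly_def)

lemma residue_poly_sum: "residue_poly r (\<Sum>i\<in>S. g i) = (\<Sum>i\<in>S. residue_poly r (g i))"
  by (induction S rule: infinite_finite_induct) (simp_all add: residue_poly_add)

lemma residue_poly_uminus: "residue_poly r (- f) = - residue_poly r f"
  using residue_poly_add[of r f "- f"] by (simp add: eq_neg_iff_add_eq_0 add.commute)

lemma residue_poly_sign: "residue_poly r ((- 1) ^ n * f) = (- 1) ^ n * residue_poly r f"
  by (cases "even n") (simp_all add: residue_poly_uminus)

lemma residue_poly_pX: "residue_poly r (pX ^ a * f) = pX ^ a * residue_poly r f"
proof -
  have *: "pX ^ a = monom 1 a" by (simp add: pX_def monom_altdef)
  show ?thesis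
    by (rule poly_eqI) (simp add: coeff_residue_poly * coeff_monom_mult)
qed

text \<open>
  A monomial times a Laurent polynomial in \<open>q\<^sup>3\<close> has all its exponents in one residue class.
\<close>

lemma residue_poly_shift:
  "residue_poly r (qX j * q_cubed_poly g) = (if 3 dvd j - r then qX ((j - r) div 3) * g else 0)"
proof (rule poly_eqI)
  fix k
  have "residue_part r (Poly_Mapping.single j 1 * q_cubed f) =
    (if 3 dvd j - r then Poly_Mapping.single ((j - r) div 3) 1 * f else 0)" for f
  proof (rule poly_mapping_eqI)
    fix i
    show "Poly_Mapping.lookup (residue_part r (Poly_Mapping.single j 1 * q_cubed f)) i =
      Poly_Mapping.lookup (if 3 dvd j - r then Poly_Mapping.single ((j - r) div 3) 1 * f else 0) i"
    proof (cases "3 dvd j - r")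
      case True
      then have "(3 * i + r - j) mod 3 = 0" "(3 * i + r - j) div 3 = i - (j - r) div 3"
        by presburger+
      then show ?thesis using True by (simp add: lookup_residue_part lookup_shift lookup_q_cubed)
    next
      case False
      then have "(3 * i + r - j) mod 3 \<noteq> 0" by presburger
      then show ?thesis using False by (simp add: lookup_residue_part lookup_shift lookup_q_cubed)
    qed
  qed
  then show "coeff (residue_poly r (qX j * q_cubed_poly g)) k =
      coeff (if 3 dvd j - r then qX ((j - r) div 3) * g else 0) k"
    by (simp add: coeff_residue_poly qX_def q_cubed_poly_def coeff_map_poly)
qed

lemma F_components:
  assumes "l \<in> {0, 1, 2::nat}"
  shows "[F0 m n, F1 m n, F2 m n] ! l = (- 1) ^ ((l + 1) choose 2) * residue_poly (int l) (F_prod m n)"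
proof -
  have z: "coeff (F_prod m n) k = 0" if "\<not> k \<le> 2 * m * (m + 1) * n" for k
    using degree_F_prod[of m n] that by (intro coeff_eq_0) linarith
  have "F0 m n = residue_poly 0 (F_prod m n)"
    unfolding F0_def unfolding A_coeff_def
    by (rule poly_eqI, subst coeff_pX_sum) (simp add: coeff_residue_poly z)
  moreover have "F1 m n = - residue_poly 1 (F_prod m n)"
    unfolding F1_def unfolding B_coeff_def
    by (rule poly_eqI, subst coeff_pX_sum) (simp add: coeff_residue_poly z)
  moreover have "F2 m n = - residue_poly 2 (F_prod m n)"
    unfolding F2_def unfolding C_coeff_def
    by (rule poly_eqI, subst coeff_pX_sum) (simp add: coeff_residue_poly z)
  moreover have "(1::nat) choose 2 = 0" "(2::nat) choose 2 = 1" "(3::nat) choose 2 = 3"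
    by (simp_all add: numeral_2_eq_2 numeral_3_eq_3)
  ultimately show ?thesis using assms by (auto simp: numeral_2_eq_2)
qed

text \<open>
  Three times the exponent of \<open>q\<close> that accompanies the coefficient of \<open>y\<^sup>c\<close> in the part of residue \<open>l\<close>:
  \<open>y\<close> is \<open>q\<^sup>2\<^sup>-\<^sup>3\<^sup>n\<close>, and the bracket is the exponent of the monomial in \<open>prod_gen_factors\<close>.
\<close>

definition residue_exponent :: "nat \<Rightarrow> nat \<Rightarrow> nat \<Rightarrow> nat \<Rightarrow> int" where
  "residue_exponent m n l c = (2 - 3 * int n) * int c - (int m * int n - int n - 3 * int (n choose 2)) - int l"

text \<open>
  Dividing \<open>prod_gen_factors\<close> by its \<open>q\<close>-monomial writes \<open>F_prod\<close> as a sum of terms \<open>q\<^sup>j g(q\<^sup>3)\<close>, and each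
  of them contributes to one residue part only.
\<close>

lemma residue_poly_F_prod:
  "pX ^ (n * m * (3 * m + 1)) * residue_poly (int l) (F_prod m n) =
    (- 1) ^ n * (\<Sum>c\<le>2 * n * (2 * m + 1).
      if 3 dvd residue_exponent m n l c then qX (residue_exponent m n l c div 3) * coeff (product_poly m n) c else 0)"
proof -
  define e where "e = int m * int n - int n - 3 * int (n choose 2)"
  define y where "y = qX (2 - 3 * int n)"
  let ?H = "map_poly q_cubed_poly (product_poly m n)" and ?D = "2 * n * (2 * m + 1)"
  have "?H = (\<Prod>i<2*m+1. \<Prod>k<2*n. [:pX ^ m, - (pX ^ i * qX (3 * int k)):])"
  proof -
    have hom: "map_poly q_cubed_poly (\<Prod>i\<in>S. g i) = (\<Prod>i\<in>S. map_poly q_cubed_poly (g i))"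
      for g and S :: "nat set"
      by (rule map_poly_hom_prod) (simp_all add: q_cubed_poly_add q_cubed_poly_mult)
    show ?thesis
      unfolding product_poly_def hom
      by (simp add: q_cubed_poly_mult map_poly_pCons q_cubed_poly_uminus q_cubed_poly_power
          q_cubed_poly_pX q_cubed_poly_qX del: prod.lessThan_Suc)
  qed
  moreover have "poly [:pX ^ m, - (pX ^ i * qX (3 * int k)):] y =
      pX ^ m - pX ^ i * qX (3 * int k + 2 - 3 * int n)" for i k
  proof -
    have "y * (pX ^ i * qX (3 * int k)) = pX ^ i * (qX (3 * int k) * y)"
      by (simp only: mult_ac)
    also have "\<dots> = pX ^ i * qX (3 * int k + 2 - 3 * int n)"
      by (simp add: y_def qX_mult add_diff_eq)
    finally show ?thesis by simp
  qed
  ultimately have "poly ?H y =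
      (\<Prod>i<2*m+1. \<Prod>k<2*n. pX ^ m - pX ^ i * qX (3 * int k + 2 - 3 * int n))"
    by (simp only: poly_prod)
  then have F: "poly ?H y = (- 1) ^ n * pX ^ (n * m * (3 * m + 1)) * qX e * F_prod m n"
    by (simp only: prod_gen_factors e_def)
  have "poly ?H y = (\<Sum>c\<le>degree ?H. coeff ?H c * y ^ c)" by (rule poly_altdef)
  also have "\<dots> = (\<Sum>c\<le>?D. coeff ?H c * y ^ c)"
    using map_poly_degree_leq[of q_cubed_poly "product_poly m n"] degree_product_poly[of m n]
    by (intro sum.mono_neutral_left) (auto simp: coeff_eq_0)
  finally have H: "poly ?H y = (\<Sum>c\<le>?D. q_cubed_poly (coeff (product_poly m n) c) * qX (int c * (2 - 3 * int n)))"
    by (simp only: y_def qX_power coeff_map_poly q_cubed_poly_simps)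
  have sgn: "(- 1) ^ n * (- 1) ^ n = (1 :: laurent poly)"
    by (simp flip: power_mult_distrib)
  have "pX ^ (n * m * (3 * m + 1)) * F_prod m n = (- 1) ^ n * (qX (- e) * poly ?H y)"
  proof -
    have "(- 1) ^ n * (qX (- e) * poly ?H y) = ((- 1) ^ n * (- 1) ^ n) * (qX (- e) * qX e) *
      (pX ^ (n * m * (3 * m + 1)) * F_prod m n)"
      unfolding F by (simp only: mult_ac)
    then show ?thesis unfolding sgn by (simp add: qX_mult qX_0)
  qed
  also have "qX (- e) * poly ?H y =
      (\<Sum>c\<le>?D. qX ((2 - 3 * int n) * int c - e) * q_cubed_poly (coeff (product_poly m n) c))"
    unfolding H sum_distrib_left
  proof (rule sum.cong, rule refl)
    fix c
    have "qX (- e) * (q_cubed_poly (coeff (product_poly m n) c) * qX (int c * (2 - 3 * int n))) =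
        qX (- e) * qX (int c * (2 - 3 * int n)) * q_cubed_poly (coeff (product_poly m n) c)"
      by (simp only: mult_ac)
    also have "qX (- e) * qX (int c * (2 - 3 * int n)) = qX ((2 - 3 * int n) * int c - e)"
      by (simp add: qX_mult algebra_simps)
    finally show "qX (- e) * (q_cubed_poly (coeff (product_poly m n) c) * qX (int c * (2 - 3 * int n))) =
      qX ((2 - 3 * int n) * int c - e) * q_cubed_poly (coeff (product_poly m n) c)" .
  qed
  finally have "residue_poly (int l) (pX ^ (n * m * (3 * m + 1)) * F_prod m n) =
     residue_poly (int l) ((- 1) ^ n *
       (\<Sum>c\<le>?D. qX ((2 - 3 * int n) * int c - e) * q_cubed_poly (coeff (product_poly m n) c)))"
    by (rule arg_cong)
  then show ?thesis
    unfolding residue_poly_pX residue_poly_sign residue_poly_sum residue_poly_shift residue_exponent_def e_def .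
qed

lemma to_fract_residue_poly_F_prod:
  "p_var ^ (n * m * (3 * m + 1)) * to_fract (residue_poly (int l) (F_prod m n)) =
    (\<Sum>lam | lam \<in> box_partitions (2*m+1) (2*n) \<and> 3 dvd residue_exponent m n l (\<Sum>i=1..2*m+1. lam i).
      (- 1) ^ n * q_var powi (residue_exponent m n l (\<Sum>i=1..2*m+1. lam i) div 3) *
        (pq.summand (2*m+1) (2*n) lam * p_var ^ (m * (2 * n * (2*m+1) - (\<Sum>i=1..2*m+1. lam i)))))"
    (is "_ = ?R")
proof -
  let ?B = "box_partitions (2*m+1) (2*n)" and ?D = "2 * n * (2 * m + 1)"
  define sz where "sz = (\<lambda>lam :: nat \<Rightarrow> nat. \<Sum>i=1..2*m+1. lam i)"
  have sz: "(\<Sum>i=1..2*m+1. lam i) = sz lam" for lam by (simp only: sz_def)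
  define g where "g = (\<lambda>lam. if 3 dvd residue_exponent m n l (sz lam)
    then q_var powi (residue_exponent m n l (sz lam) div 3) * (pq.summand (2*m+1) (2*n) lam * p_var ^ (m * (?D - sz lam)))
    else 0)"
  have sign: "to_fract ((- 1) ^ n) = (- 1) ^ n" by (simp add: to_fract_power)
  have "to_fract (pX ^ (n * m * (3 * m + 1)) * residue_poly (int l) (F_prod m n)) =
    (- 1) ^ n * (\<Sum>c\<le>?D. to_fract (if 3 dvd residue_exponent m n l c
      then qX (residue_exponent m n l c div 3) * coeff (product_poly m n) c else 0))"
    unfolding residue_poly_F_prod to_fract_mult to_fract_sum sign ..
  also have "(\<Sum>c\<le>?D. to_fract (if 3 dvd residue_exponent m n l c
      then qX (residue_exponent m n l c div 3) * coeff (product_poly m n) c else 0)) =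
    (\<Sum>c\<le>?D. \<Sum>lam | lam \<in> ?B \<and> sz lam = c. g lam)"
  proof (rule sum.cong, rule refl)
    fix c
    show "to_fract (if 3 dvd residue_exponent m n l c
        then qX (residue_exponent m n l c div 3) * coeff (product_poly m n) c else 0) =
      (\<Sum>lam | lam \<in> ?B \<and> sz lam = c. g lam)"
    proof (cases "3 dvd residue_exponent m n l c")
      case True
      have "to_fract (qX (residue_exponent m n l c div 3) * coeff (product_poly m n) c) =
        (\<Sum>lam | lam \<in> ?B \<and> sz lam = c. q_var powi (residue_exponent m n l c div 3) *
          (pq.summand (2*m+1) (2*n) lam * p_var ^ (m * (?D - c))))"
        unfolding to_fract_mult to_fract_coeff_product_poly to_fract_qX sum_distrib_left sz_def ..
      also have "\<dots> = (\<Sum>lam | lam \<in> ?B \<and> sz lam = c. g lam)"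
        using True by (intro sum.cong) (auto simp: g_def)
      finally show ?thesis using True by simp
    next
      case False
      then show ?thesis by (auto simp: g_def intro!: sum.neutral)
    qed
  qed
  also have "\<dots> = (\<Sum>lam\<in>?B. g lam)"
    using box_size_le[of _ "2*m+1" "2*n"]
    by (intro sum.group) (auto simp: sz_def)
  also have "(- 1) ^ n * (\<Sum>lam\<in>?B. g lam) = ?R"
    unfolding sum_distrib_left sz g_def
    by (subst sum.inter_filter) (auto intro!: sum.cong simp: mult.assoc)
  finally show ?thesis by (simp add: to_fract_power p_var_def)
qed

section \<open>From partitions in a box to non-increasing integer sequences\<close>

definition shift_up :: "nat \<Rightarrow> nat \<Rightarrow> (nat \<Rightarrow> int) \<Rightarrow> nat \<Rightarrow> nat" where
  "shift_up N n lam = (\<lambda>i\<in>{1..N}. nat (int n + lam i))"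

definition shift_down :: "nat \<Rightarrow> nat \<Rightarrow> (nat \<Rightarrow> nat) \<Rightarrow> nat \<Rightarrow> int" where
  "shift_down N n mu = (\<lambda>i\<in>{1..N}. int (mu i) - int n)"

lemma noninc_seqsD:
  assumes "lam \<in> noninc_seqs N n"
  shows "i \<in> {1..N} \<Longrightarrow> - int n \<le> lam i" "i \<in> {1..N} \<Longrightarrow> lam i \<le> int n"
    and "i \<in> {1..N} \<Longrightarrow> j \<in> {1..N} \<Longrightarrow> i \<le> j \<Longrightarrow> lam j \<le> lam i"
    and "i \<notin> {1..N} \<Longrightarrow> lam i = undefined"
  using assms by (auto simp: noninc_seqs_def PiE_iff extensional_def)

lemma shift_up_nth:
  assumes "lam \<in> noninc_seqs N n" "i \<in> {1..N}"
  shows "int (shift_up N n lam i) = lam i + int n"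
  using noninc_seqsD(1)[OF assms] assms(2) by (simp add: shift_up_def)

lemma shift_up_in_box:
  assumes lam: "lam \<in> noninc_seqs N n"
  shows "shift_up N n lam \<in> box_partitions N (2 * n)"
proof -
  have "shift_up N n lam i \<le> 2 * n" if "i \<in> {1..N}" for i
    using shift_up_nth[OF lam that] noninc_seqsD(2)[OF lam that] by linarith
  moreover have "shift_up N n lam j \<le> shift_up N n lam i" if "i \<in> {1..N}" "j \<in> {1..N}" "i \<le> j" for i j
    using shift_up_nth[OF lam that(1)] shift_up_nth[OF lam that(2)] noninc_seqsD(3)[OF lam that]
    by linarith
  ultimately show ?thesis
    by (auto simp: box_partitions_def PiE_iff extensional_def shift_up_def)
qed

lemma shift_down_in_seqs:
  assumes mu: "mu \<in> box_partitions N (2 * n)"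
  shows "shift_down N n mu \<in> noninc_seqs N n"
proof -
  have "int (mu i) \<le> 2 * int n" if "i \<in> {1..N}" for i
    using box_partitionsD(1)[OF mu that] by linarith
  then show ?thesis
    using box_partitionsD(2)[OF mu]
    by (auto simp: noninc_seqs_def PiE_iff extensional_def shift_down_def)
qed

lemma shift_up_down: "mu \<in> box_partitions N M \<Longrightarrow> shift_up N n (shift_down N n mu) = mu"
  using box_partitionsD(3)[of mu N M] by (auto simp: shift_up_def shift_down_def fun_eq_iff)

lemma shift_down_up: "lam \<in> noninc_seqs N n \<Longrightarrow> shift_down N n (shift_up N n lam) = lam"
  using noninc_seqsD(4)[of lam N n] shift_up_nth[of lam N n]
  by (auto simp: shift_down_def fun_eq_iff)

lemma size_shift_up:
  assumes "lam \<in> noninc_seqs N n"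
  shows "int (\<Sum>i=1..N. shift_up N n lam i) = (\<Sum>i=1..N. lam i) + int n * int N"
proof -
  have "int (\<Sum>i=1..N. shift_up N n lam i) = (\<Sum>i=1..N. lam i + int n)"
    unfolding of_nat_sum by (intro sum.cong refl shift_up_nth assms)
  then show ?thesis by (simp add: sum.distrib)
qed

lemma two_choose_two: "2 * int (k choose 2) = int k * (int k - 1)"
proof (induction k)
  case (Suc k)
  then show ?case by (simp add: choose_two_Suc algebra_simps)
qed (simp add: numeral_2_eq_2)

lemma choose_two_shift:
  assumes "int u = a + int n"
  shows "int (u choose 2) = a * (a + 1) div 2 + (int n - 1) * a + int (n choose 2)"
proof -
  have "2 * (a * (a + 1) div 2) = a * (a + 1)" by simp
  moreover have "2 * int (u choose 2) = (a + int n) * (a + int n - 1)"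
    using two_choose_two[of u] assms by simp
  ultimately have "2 * int (u choose 2) =
      2 * (a * (a + 1) div 2 + (int n - 1) * a + int (n choose 2))"
    using two_choose_two[of n] by (simp add: algebra_simps)
  then show ?thesis by simp
qed

text \<open>
  With \<open>c = |\<lambda>| + n N\<close> the exponent is \<open>-(|\<lambda>| + l)\<close> up to a multiple of \<open>3\<close>; this is where
  the congruence condition on \<open>|\<lambda>|\<close> comes from.
\<close>

lemma residue_exponent_dvd_iff:
  assumes "int c = L + int n * int (2 * m + 1)"
  shows "3 dvd residue_exponent m n l c \<longleftrightarrow> 3 dvd L + int l"
proof -
  have "residue_exponent m n l c = 3 * (L + int m * int n + int n - int n * L - 2 * int m * int n * int n -
      int n * int n + int (n choose 2)) - (L + int l)"
    unfolding residue_exponent_def assms by (simp add: algebra_simps)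
  then show ?thesis by presburger
qed

lemma q_exponent:
  assumes lam: "lam \<in> noninc_seqs (2*m+1) n"
    and l: "3 dvd (\<Sum>i=1..2*m+1. lam i) + int l"
  shows "residue_exponent m n l (\<Sum>i=1..2*m+1. shift_up (2*m+1) n lam i) div 3 +
      int (\<Sum>i=1..2*m+1. shift_up (2*m+1) n lam i choose 2) =
    - int (m * n\<^sup>2) + ((\<Sum>i=1..2*m+1. lam i * (lam i + 1) div 2)
                   - ((\<Sum>i=1..2*m+1. lam i) + int l) div 3)"
proof -
  define L C E where "L = (\<Sum>i=1..2*m+1. lam i)" and "C = int (n choose 2)"
    and "E = (\<Sum>i=1..2*m+1. lam i * (lam i + 1) div 2)"
  obtain u where u: "L + int l = 3 * u" using l by (auto simp: L_def)
  have C: "int n * int n = 2 * C + int n"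
    using two_choose_two[of n] by (simp add: C_def algebra_simps)
  have "int (\<Sum>i=1..2*m+1. shift_up (2*m+1) n lam i choose 2) =
      (\<Sum>i=1..2*m+1. lam i * (lam i + 1) div 2 + (int n - 1) * lam i + C)"
    unfolding of_nat_sum C_def
    by (intro sum.cong refl choose_two_shift shift_up_nth[OF lam])
  also have "\<dots> = E + (int n - 1) * L + (2 * int m + 1) * C"
    unfolding E_def L_def sum.distrib sum_distrib_left by (simp add: algebra_simps)
  finally have ch: "int (\<Sum>i=1..2*m+1. shift_up (2*m+1) n lam i choose 2) =
      E + (int n - 1) * L + (2 * int m + 1) * C" .
  have L: "L = 3 * u - int l" using u by simp
  have "residue_exponent m n l (\<Sum>i=1..2*m+1. shift_up (2*m+1) n lam i) =
      3 * (2 * u - int l - 3 * int n * u + int n * int l + int m * int n + int n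
        - 2 * int m * (int n * int n) - int n * int n + C)"
    unfolding residue_exponent_def size_shift_up[OF lam] L_def[symmetric] L C_def[symmetric]
    by (simp add: algebra_simps)
  then have tw: "residue_exponent m n l (\<Sum>i=1..2*m+1. shift_up (2*m+1) n lam i) div 3 =
      2 * u - int l - 3 * int n * u + int n * int l + int m * int n + int n
        - 2 * int m * (int n * int n) - int n * int n + C"
    by simp
  have mn: "int (m * n\<^sup>2) = int m * (int n * int n)" by (simp add: power2_eq_square)
  show ?thesis
    unfolding ch tw mn E_def[symmetric] L_def[symmetric] u unfolding L C
    by (simp add: algebra_simps)
qed

lemma p_exponent:
  assumes lam: "lam \<in> noninc_seqs (2*m+1) n"
  shows "int (\<Sum>i=1..2*m+1. (i - 1) * shift_up (2*m+1) n lam i) +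
      int (m * (2 * n * (2*m+1) - (\<Sum>i=1..2*m+1. shift_up (2*m+1) n lam i))) =
    int (n * m * (3 * m + 1)) + int (m * (m + 1) * n) + (\<Sum>i=1..2*m+1. (int i - 1 - int m) * lam i)"
proof -
  define L P where "L = (\<Sum>i=1..2*m+1. lam i)" and "P = (\<Sum>i=1..2*m+1. (int i - 1) * lam i)"
  have tri: "(\<Sum>i=1..2*m+1. int i - 1) = int m * (2 * int m + 1)"
    by (induction m) (simp_all add: algebra_simps)
  have "int (\<Sum>i=1..2*m+1. (i - 1) * shift_up (2*m+1) n lam i) =
      (\<Sum>i=1..2*m+1. (int i - 1) * lam i + int n * (int i - 1))"
    unfolding of_nat_sum
  proof (rule sum.cong, rule refl)
    fix i assume i: "i \<in> {1..2*m+1}"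
    then have "int (i - 1) = int i - 1" by auto
    then show "int ((i - 1) * shift_up (2*m+1) n lam i) = (int i - 1) * lam i + int n * (int i - 1)"
      unfolding of_nat_mult shift_up_nth[OF lam i] by (simp only:) (simp add: algebra_simps)
  qed
  also have "\<dots> = P + int n * (int m * (2 * int m + 1))"
    unfolding P_def sum.distrib sum_distrib_left[symmetric] tri ..
  finally have 1: "int (\<Sum>i=1..2*m+1. (i - 1) * shift_up (2*m+1) n lam i) =
      P + int n * (int m * (2 * int m + 1))" .
  have 2: "int (m * (2 * n * (2*m+1) - (\<Sum>i=1..2*m+1. shift_up (2*m+1) n lam i))) =
      int m * (2 * int n * (2 * int m + 1) - (L + int n * (2 * int m + 1)))"
    using box_size_le[OF shift_up_in_box[OF lam]] size_shift_up[OF lam]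
    by (simp only: of_nat_mult of_nat_diff L_def) simp
  have 3: "(\<Sum>i=1..2*m+1. (int i - 1 - int m) * lam i) = P - int m * L"
    unfolding P_def L_def sum_distrib_left sum_subtractf[symmetric]
    by (intro sum.cong refl) (simp add: algebra_simps)
  show ?thesis unfolding 1 2 3 by (simp add: algebra_simps)
qed

text \<open>
  The substitution \<open>\<mu> = \<lambda> + n\<close> does not change the pair factors and turns the row factors into those
  for \<open>\<lambda>\<close>; the rest is the comparison of signs and exponents in \<open>p_exponent\<close> and \<open>q_exponent\<close>.
\<close>

lemma summand_shift_up:
  assumes lam: "lam \<in> noninc_seqs (2*m+1) n"
    and l: "3 dvd (\<Sum>i=1..2*m+1. lam i) + int l"
  defines "mu \<equiv> shift_up (2*m+1) n lam"
  shows "(- 1) ^ n * q_var powi (residue_exponent m n l (\<Sum>i=1..2*m+1. mu i) div 3) *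
        (pq.summand (2*m+1) (2*n) mu * p_var ^ (m * (2 * n * (2*m+1) - (\<Sum>i=1..2*m+1. mu i)))) =
    p_var ^ (n * m * (3 * m + 1)) * (p_var ^ (m * (m + 1) * n) * q_var powi (- int (m * n\<^sup>2)) *
      ((\<Prod>(i, j) \<in> {(i, j). 1 \<le> i \<and> i < j \<and> j \<le> 2*m+1}.
          ((1 - p_var ^ (j - i) * q_var ^ nat (lam i - lam j))
             * qpoch (p_var ^ (j - i + 1)) q_var (nat (lam i - lam j)))
          / ((1 - p_var ^ (j - i))
             * qpoch (p_var ^ (j - i - 1) * q_var) q_var (nat (lam i - lam j)))) *
       (\<Prod>i=1..2*m+1.
          qpoch (p_var ^ (i - 1) * q_var) q_var (2 * n)
          / (qpoch (p_var ^ (i - 1) * q_var) q_var (nat (int n - lam i))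
             * qpoch (p_var ^ (2*m+1 - i) * q_var) q_var (nat (int n + lam i)))) *
       (- 1) powi (\<Sum>i=1..2*m+1. lam i) *
       p_var powi (\<Sum>i=1..2*m+1. (int i - 1 - int m) * lam i) *
       q_var powi ((\<Sum>i=1..2*m+1. lam i * (lam i + 1) div 2)
                   - ((\<Sum>i=1..2*m+1. lam i) + int l) div 3)))"
    (is "_ = _ * (_ * _ * (?V * ?R * _ * _ * _))")
proof -
  let ?N = "2*m+1"
  define s where "s = (\<Sum>i=1..?N. mu i)"
  have nth: "int (mu i) = lam i + int n" if "i \<in> {1..?N}" for i
    unfolding mu_def by (rule shift_up_nth[OF lam that])
  have pairs: "(\<Prod>(i, j)\<in>index_pairs ?N. pq.pair_factor (j - i) (mu i - mu j)) = ?V"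
    unfolding index_pairs_def
  proof (rule prod.cong, rule refl, clarify)
    fix i j assume ij: "1 \<le> i" "i < j" "j \<le> ?N"
    have "mu i - mu j = nat (lam i - lam j)" using nth[of i] nth[of j] ij by auto
    then show "pq.pair_factor (j - i) (mu i - mu j) =
      ((1 - p_var ^ (j - i) * q_var ^ nat (lam i - lam j))
             * qpoch (p_var ^ (j - i + 1)) q_var (nat (lam i - lam j)))
          / ((1 - p_var ^ (j - i))
             * qpoch (p_var ^ (j - i - 1) * q_var) q_var (nat (lam i - lam j)))"
      by (simp only: pq.pair_factor_def)
  qed
  have "(\<Prod>i=1..?N. pq.row_factor ?N (2*n) i (mu i)) =
    (\<Prod>i=1..?N. qpoch (p_var ^ (i - 1) * q_var) q_var (2 * n)
          / (qpoch (p_var ^ (i - 1) * q_var) q_var (nat (int n - lam i))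
             * qpoch (p_var ^ (2*m+1 - i) * q_var) q_var (nat (int n + lam i))) *
       ((- 1) ^ mu i * p_var ^ ((i - 1) * mu i) * q_var ^ (mu i choose 2)))"
  proof (rule prod.cong, rule refl)
    fix i assume i: "i \<in> {1..?N}"
    have "2 * n - mu i = nat (int n - lam i)" "mu i = nat (int n + lam i)"
      using nth[OF i] by auto
    then show "pq.row_factor ?N (2*n) i (mu i) = qpoch (p_var ^ (i - 1) * q_var) q_var (2 * n)
          / (qpoch (p_var ^ (i - 1) * q_var) q_var (nat (int n - lam i))
             * qpoch (p_var ^ (2*m+1 - i) * q_var) q_var (nat (int n + lam i))) *
       ((- 1) ^ mu i * p_var ^ ((i - 1) * mu i) * q_var ^ (mu i choose 2))"
      unfolding pq.row_factor_def by metis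
  qed
  then have rows: "(\<Prod>i=1..?N. pq.row_factor ?N (2*n) i (mu i)) =
    ?R * ((- 1) ^ s * p_var ^ (\<Sum>i=1..?N. (i - 1) * mu i) * q_var ^ (\<Sum>i=1..?N. mu i choose 2))"
    by (simp only: prod.distrib power_sum s_def)
  have sign: "(- 1) ^ n * (- 1) ^ s = ((- 1) powi (\<Sum>i=1..?N. lam i) :: ratfun)"
  proof -
    have "int (n + s) = (\<Sum>i=1..?N. lam i) + int (2 * (n * (m + 1)))"
      using size_shift_up[OF lam] by (simp only: s_def mu_def of_nat_add) (simp add: algebra_simps)
    then have "(- 1 :: ratfun) powi int (n + s) =
        (- 1) powi (\<Sum>i=1..?N. lam i) * (- 1) powi int (2 * (n * (m + 1)))"
      by (simp only:) (rule power_int_add, simp)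
    then show ?thesis by (simp only: power_int_of_nat power_add power_mult) simp
  qed
  have p: "p_var ^ (\<Sum>i=1..?N. (i - 1) * mu i) * p_var ^ (m * (2 * n * (2*m+1) - s)) =
    p_var ^ (n * m * (3 * m + 1)) * p_var ^ (m * (m + 1) * n) *
      p_var powi (\<Sum>i=1..?N. (int i - 1 - int m) * lam i)"
    unfolding s_def mu_def power_int_of_nat[symmetric]
    by (simp only: power_int_add[OF disjI1[OF p_var_nz], symmetric] p_exponent[OF lam])
  have q: "q_var powi (residue_exponent m n l s div 3) * q_var ^ (\<Sum>i=1..?N. mu i choose 2) =
    q_var powi (- int (m * n\<^sup>2)) * q_var powi ((\<Sum>i=1..2*m+1. lam i * (lam i + 1) div 2)
                   - ((\<Sum>i=1..2*m+1. lam i) + int l) div 3)"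
    unfolding s_def mu_def power_int_of_nat[symmetric]
    by (simp only: power_int_add[OF disjI1[OF q_var_nz], symmetric] q_exponent[OF lam l])
  define A B where "A = ?V" and "B = ?R"
  have "(- 1) ^ n * q_var powi (residue_exponent m n l s div 3) *
      (A * (B * ((- 1) ^ s * p_var ^ (\<Sum>i=1..?N. (i - 1) * mu i) * q_var ^ (\<Sum>i=1..?N. mu i choose 2))) *
        p_var ^ (m * (2 * n * (2*m+1) - s))) =
    A * B * ((- 1) ^ n * (- 1) ^ s) *
      (p_var ^ (\<Sum>i=1..?N. (i - 1) * mu i) * p_var ^ (m * (2 * n * (2*m+1) - s))) *
      (q_var powi (residue_exponent m n l s div 3) * q_var ^ (\<Sum>i=1..?N. mu i choose 2))"
    by (simp only: mult_ac)
  then show ?thesis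
    unfolding pq.summand_def pairs rows s_def[symmetric] sign p q A_def B_def by (simp only: mult_ac)
qed

section \<open>The dissection\<close>

theorem theorem4:
  fixes m n l :: nat
  assumes "l \<in> {0, 1, 2}"
  shows "to_fract ([F0 m n, F1 m n, F2 m n] ! l) =
    (- 1) ^ ((l + 1) choose 2) * p_var ^ (m * (m + 1) * n) * q_var powi (- int (m * n\<^sup>2)) *
    (\<Sum>lam | lam \<in> noninc_seqs (2*m+1) n \<and> [(\<Sum>i=1..2*m+1. lam i) = - int l] (mod 3).
       (\<Prod>(i, j) \<in> {(i, j). 1 \<le> i \<and> i < j \<and> j \<le> 2*m+1}.
          ((1 - p_var ^ (j - i) * q_var ^ nat (lam i - lam j))
             * qpoch (p_var ^ (j - i + 1)) q_var (nat (lam i - lam j)))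
          / ((1 - p_var ^ (j - i))
             * qpoch (p_var ^ (j - i - 1) * q_var) q_var (nat (lam i - lam j)))) *
       (\<Prod>i=1..2*m+1.
          qpoch (p_var ^ (i - 1) * q_var) q_var (2 * n)
          / (qpoch (p_var ^ (i - 1) * q_var) q_var (nat (int n - lam i))
             * qpoch (p_var ^ (2*m+1 - i) * q_var) q_var (nat (int n + lam i)))) *
       (- 1) powi (\<Sum>i=1..2*m+1. lam i) *
       p_var powi (\<Sum>i=1..2*m+1. (int i - 1 - int m) * lam i) *
       q_var powi ((\<Sum>i=1..2*m+1. lam i * (lam i + 1) div 2)
                   - ((\<Sum>i=1..2*m+1. lam i) + int l) div 3))"
    (is "_ = ?sgn * ?P * ?Q * (\<Sum>lam\<in>?S. ?term lam)")
proof -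
  let ?N = "2*m+1" and ?E = "p_var ^ (n * m * (3 * m + 1))"
  let ?B = "{mu. mu \<in> box_partitions ?N (2*n) \<and> 3 dvd residue_exponent m n l (\<Sum>i=1..?N. mu i)}"
  have S: "?S = {lam. lam \<in> noninc_seqs ?N n \<and> 3 dvd (\<Sum>i=1..?N. lam i) + int l}"
    by (simp add: cong_iff_dvd_diff)
  have dvd: "3 dvd residue_exponent m n l (\<Sum>i=1..?N. shift_up ?N n lam i) \<longleftrightarrow> 3 dvd (\<Sum>i=1..?N. lam i) + int l"
    if "lam \<in> noninc_seqs ?N n" for lam
    by (rule residue_exponent_dvd_iff) (rule size_shift_up[OF that])
  \<comment> \<open>The common power of p comes from clearing denominators and is cancelled at the end.\<close>
  have "?E * to_fract (residue_poly (int l) (F_prod m n)) =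
    (\<Sum>mu\<in>?B. (- 1) ^ n * q_var powi (residue_exponent m n l (\<Sum>i=1..?N. mu i) div 3) *
        (pq.summand ?N (2*n) mu * p_var ^ (m * (2 * n * ?N - (\<Sum>i=1..?N. mu i)))))"
    by (rule to_fract_residue_poly_F_prod)
  also have "\<dots> = (\<Sum>lam\<in>?S. ?E * (?P * ?Q * ?term lam))"
  proof (rule sum.reindex_bij_witness[of _ "shift_up ?N n" "shift_down ?N n"])
    fix mu assume mu: "mu \<in> ?B"
    then have box: "mu \<in> box_partitions ?N (2*n)" by simp
    show ud: "shift_up ?N n (shift_down ?N n mu) = mu" by (rule shift_up_down[OF box])
    have seq: "shift_down ?N n mu \<in> noninc_seqs ?N n" by (rule shift_down_in_seqs[OF box])
    have d: "3 dvd (\<Sum>i=1..?N. shift_down ?N n mu i) + int l"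
      using dvd[OF seq] mu unfolding ud by blast
    show "shift_down ?N n mu \<in> ?S" unfolding S using seq d by blast
    show "?E * (?P * ?Q * ?term (shift_down ?N n mu)) =
      (- 1) ^ n * q_var powi (residue_exponent m n l (\<Sum>i=1..?N. mu i) div 3) *
        (pq.summand ?N (2*n) mu * p_var ^ (m * (2 * n * ?N - (\<Sum>i=1..?N. mu i))))"
      using summand_shift_up[OF seq d] unfolding ud by (rule sym)
  next
    fix lam assume "lam \<in> ?S"
    then have lam: "lam \<in> noninc_seqs ?N n" "3 dvd (\<Sum>i=1..?N. lam i) + int l"
      unfolding S by blast+
    show "shift_down ?N n (shift_up ?N n lam) = lam" by (rule shift_down_up[OF lam(1)])
    show "shift_up ?N n lam \<in> ?B"
      using shift_up_in_box[OF lam(1)] dvd[OF lam(1)] lam(2) by blast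
  qed
  also have "\<dots> = ?E * (?P * ?Q * (\<Sum>lam\<in>?S. ?term lam))"
    by (simp only: sum_distrib_left)
  finally have "to_fract (residue_poly (int l) (F_prod m n)) = ?P * ?Q * (\<Sum>lam\<in>?S. ?term lam)"
    using p_var_nz by (simp only: mult_cancel_left power_not_zero) simp
  then show ?thesis
    unfolding F_components[OF assms] to_fract_mult to_fract_power to_fract_uminus to_fract_1
    by (simp only: mult.assoc)
qed

end
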